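(* Let $a<b$ be real numbers. There exists a positive constant $C_P$ such that for $x_0\in\{a,b\}$ it holds that $$\|u\|_{L^2(a,b)}\leq C_P\Big(\|u'\|_{L^2(a,b)}+|T_0u(x_0)|\Big)$$ for all $u\in H^1(a,b)$, where $T_0:H^1(a,b)\to L^2(\{a,b\})$ is the trace operator of order zero, i.e. the unique bounded linear operator with $T_0u=u|_{\{a,b\}}$ for all $u\in C^1([a,b])$.
   Context: $C^1([a,b])$ is the set of all complex-valued continuously differentiable functions on $[a,b]$. The space $H^1(a,b)$ is the completion of $C^1([a,b])$ with respect to the norm $$\|u\|_{H^1(a,b)}:=\Big(\int_a^b|u(x)|^2\,dx+\int_a^b|u'(x)|^2\,dx\Big)^{1/2};$$ its elements are identified with the functions $u\in L^2(a,b)$ whose (weak) derivative $u'$ also belongs to $L^2(a,b)$. $L^2(\{a,b\})$ is the space of all functions $\varphi:\{a,b\}\to\mathbb{C}$, endowed with the norm $\|\varphi\|_{L^2(\{a,b\})}:=\big(|\varphi(a)|^2+|\varphi(b)|^2\big)^{1/2}$. The trace operator of order zero $T_0:H^1(a,b)\to L^2(\{a,b\})$ is the unique extension to a bounded linear operator on $H^1(a,b)$ of the restriction map $C^1([a,b])\to L^2(\{a,b\})$, $u\mapsto u|_{\{a,b\}}$ (such an extension exists and is unique). $T_0u(x_0)$ denotes the value of the function $T_0u:\{a,b\}\to\mathbb{C}$ at $x_0$. *)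

theory Defs
  imports "HOL-Analysis.Analysis"
begin

(* Functions on (a,b) are represented by functions real => complex; values outside the
   interval are irrelevant, and elements of L^2 and H^1 are representatives of classes
   modulo equality almost everywhere. *)

definition L2 :: "real \<Rightarrow> real \<Rightarrow> (real \<Rightarrow> complex) set" where
  "L2 a b = {u. u \<in> borel_measurable (lebesgue_on {a<..<b}) \<and>
                integrable (lebesgue_on {a<..<b}) (\<lambda>x. (norm (u x))\<^sup>2)}"

definition L2_norm :: "real \<Rightarrow> real \<Rightarrow> (real \<Rightarrow> complex) \<Rightarrow> real" where
  "L2_norm a b u = sqrt (LINT x|lebesgue_on {a<..<b}. (norm (u x))\<^sup>2)"

(* C_c^infinity(a,b).  Real-valued test functions suffice, since the weak-derivative
   identity is complex-linear in the test function. *)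
definition test_function :: "real \<Rightarrow> real \<Rightarrow> (real \<Rightarrow> real) \<Rightarrow> bool" where
  "test_function a b \<phi> \<longleftrightarrow>
     (\<forall>n x. ((deriv ^^ n) \<phi>) differentiable (at x)) \<and>
     (\<exists>K. compact K \<and> K \<subseteq> {a<..<b} \<and> (\<forall>x. x \<notin> K \<longrightarrow> \<phi> x = 0))"

(* Only used for u, v in L2 a b, so that both integrands are integrable. *)
definition has_weak_deriv ::
    "real \<Rightarrow> real \<Rightarrow> (real \<Rightarrow> complex) \<Rightarrow> (real \<Rightarrow> complex) \<Rightarrow> bool" where
  "has_weak_deriv a b u v \<longleftrightarrow>
     (\<forall>\<phi>. test_function a b \<phi> \<longrightarrow>
        (LINT x|lebesgue_on {a<..<b}. deriv \<phi> x *\<^sub>R u x) =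
        - (LINT x|lebesgue_on {a<..<b}. \<phi> x *\<^sub>R v x))"

(* The completion of C^1([a,b]) in the H^1 norm, under its identification with a space
   of L^2 functions. *)
definition H1 :: "real \<Rightarrow> real \<Rightarrow> (real \<Rightarrow> complex) set" where
  "H1 a b = {u \<in> L2 a b. \<exists>v \<in> L2 a b. has_weak_deriv a b u v}"

(* Weak derivatives are unique almost everywhere, so norms of weak_deriv a b u do not
   depend on the choice. *)
definition weak_deriv :: "real \<Rightarrow> real \<Rightarrow> (real \<Rightarrow> complex) \<Rightarrow> real \<Rightarrow> complex" where
  "weak_deriv a b u = (SOME v. v \<in> L2 a b \<and> has_weak_deriv a b u v)"

definition H1_norm :: "real \<Rightarrow> real \<Rightarrow> (real \<Rightarrow> complex) \<Rightarrow> real" where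
  "H1_norm a b u =
     sqrt ((LINT x|lebesgue_on {a<..<b}. (norm (u x))\<^sup>2) +
           (LINT x|lebesgue_on {a<..<b}. (norm (weak_deriv a b u x))\<^sup>2))"

(* One-sided derivatives at the end points; the library's C1_differentiable_on would
   demand two-sided ones. *)
definition C1 :: "real \<Rightarrow> real \<Rightarrow> (real \<Rightarrow> complex) set" where
  "C1 a b = {u. \<exists>u'. continuous_on {a..b} u' \<and>
       (\<forall>x\<in>{a..b}. (u has_vector_derivative u' x) (at x within {a..b}))}"

definition L2_boundary :: "real \<Rightarrow> real \<Rightarrow> (real \<Rightarrow> complex) set" where
  "L2_boundary a b = {a, b} \<rightarrow>\<^sub>E UNIV"

definition L2_boundary_norm :: "real \<Rightarrow> real \<Rightarrow> (real \<Rightarrow> complex) \<Rightarrow> real" where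
  "L2_boundary_norm a b \<phi> = sqrt ((norm (\<phi> a))\<^sup>2 + (norm (\<phi> b))\<^sup>2)"

(* Operators are extensional on H^1 and so are their values on {a,b}; this makes the
   trace operator unique as an HOL function.  Linearity and boundedness force T to agree
   on representatives that are equal almost everywhere. *)
definition is_trace_operator ::
    "real \<Rightarrow> real \<Rightarrow> ((real \<Rightarrow> complex) \<Rightarrow> real \<Rightarrow> complex) \<Rightarrow> bool" where
  "is_trace_operator a b T \<longleftrightarrow>
     T \<in> H1 a b \<rightarrow>\<^sub>E L2_boundary a b \<and>
     (\<forall>u\<in>H1 a b. \<forall>v\<in>H1 a b. \<forall>x\<in>{a, b}. T (\<lambda>y. u y + v y) x = T u x + T v x) \<and>
     (\<forall>c. \<forall>u\<in>H1 a b. \<forall>x\<in>{a, b}. T (\<lambda>y. c * u y) x = c * T u x) \<and>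
     (\<exists>B. \<forall>u\<in>H1 a b. L2_boundary_norm a b (T u) \<le> B * H1_norm a b u) \<and>
     (\<forall>u\<in>C1 a b. T u = restrict u {a, b})"

definition trace_operator ::
    "real \<Rightarrow> real \<Rightarrow> (real \<Rightarrow> complex) \<Rightarrow> real \<Rightarrow> complex" where
  "trace_operator a b = (THE T. is_trace_operator a b T)"

end

theory Submission
  imports Defs
begin

text \<open>
Every \<open>u\<close> in \<open>H1 a b\<close> agrees almost everywhere with a continuous function \<open>g\<close> on \<open>[a, b]\<close> of the form
\<open>g x = c + integral {a..x} v\<close>, where \<open>v\<close> is the weak derivative. Hence the oscillation of \<open>g\<close> is at
most the \<open>L1\<close> norm of \<open>v\<close>, and by Cauchy-Schwarz at most \<open>sqrt (b - a)\<close> times its \<open>L2\<close> norm. Comparing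
\<open>g x\<close> with \<open>g x0\<close> bounds \<open>\<bar>u\<bar>\<close> almost everywhere by \<open>\<bar>g x0\<bar> + sqrt (b - a) * L2_norm a b v\<close>, and
integrating over the interval gives the inequality (\<open>Poincare_continuous_rep\<close>), provided that \<open>g x0\<close> is
the trace of \<open>u\<close> at \<open>x0\<close>.

The representation (\<open>weak_deriv_representation\<close>) rests on two facts. The primitive of \<open>v\<close> has weak
derivative \<open>v\<close>, by Fubini's theorem (\<open>primitive_has_weak_deriv\<close>); and a function with weak derivative zero is
constant almost everywhere (\<open>du_Bois_Reymond\<close>). The latter needs a sufficient supply of test functions, built
from \<open>exp (- (1 / x))\<close>, and the fundamental lemma of the calculus of variations.

The trace operator is given by a definite description, so it must be shown to exist and to be unique. The
map that sends \<open>u\<close> to the boundary values of its continuous representative is linear because the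
representative is unique, bounded by the oscillation estimate, and correct on \<open>C1 a b\<close>
(\<open>is_trace_operator_boundary_values\<close>). Uniqueness (\<open>is_trace_operator_unique\<close>) follows from the density
of \<open>C1 a b\<close> in \<open>H1 a b\<close> (\<open>C1_dense_in_H1\<close>): approximate \<open>v\<close> in \<open>L2\<close> by continuous functions and
integrate.
\<close>

section \<open>Smooth functions and test functions\<close>

definition smooth :: "(real \<Rightarrow> real) \<Rightarrow> bool" where
  "smooth f \<longleftrightarrow> (\<forall>n x. ((deriv ^^ n) f) differentiable (at x))"

text \<open>The algebra of functions generated by \<open>F\<close>. By the Leibniz rule, derivatives of its elements stay in it
as soon as this holds for the generators. It therefore serves as an invariant for proofs by coinduction
that a function is smooth.\<close>

inductive_set generated_algebra :: "(real \<Rightarrow> real) set \<Rightarrow> (real \<Rightarrow> real) set"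
  for F :: "(real \<Rightarrow> real) set" where
  base: "f \<in> F \<Longrightarrow> f \<in> generated_algebra F"
| const: "(\<lambda>x. c) \<in> generated_algebra F"
| add: "f \<in> generated_algebra F \<Longrightarrow> g \<in> generated_algebra F
        \<Longrightarrow> (\<lambda>x. f x + g x) \<in> generated_algebra F"
| mult: "f \<in> generated_algebra F \<Longrightarrow> g \<in> generated_algebra F
        \<Longrightarrow> (\<lambda>x. f x * g x) \<in> generated_algebra F"

text \<open>One induction over the algebra replaces all bookkeeping of iterated derivatives: the algebra is closed
under \<^const>\<open>deriv\<close>, hence contains every iterated derivative of \<open>f\<close>, and all its elements are
differentiable. With different choices of \<open>F\<close> this yields closure of smooth functions under sums and
products, closure under affine substitution, and smoothness of the functions \<open>flat_exp k\<close>.\<close>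

lemma smooth_coinduct:
  assumes F: "\<And>f. f \<in> F \<Longrightarrow> \<exists>f'\<in>generated_algebra F. \<forall>x. (f has_real_derivative f' x) (at x)"
    and f: "f \<in> generated_algebra F"
  shows "smooth f"
proof -
  have step: "\<exists>f'\<in>generated_algebra F. \<forall>x. (f has_real_derivative f' x) (at x)"
    if "f \<in> generated_algebra F" for f
    using that
  proof induction
    case (base f)
    then show ?case by (rule F)
  next
    case (const c)
    show ?case
      by (rule bexI[OF _ generated_algebra.const[of 0]]) simp
  next
    case (add f g)
    then obtain f' g' where "f' \<in> generated_algebra F" "g' \<in> generated_algebra F"
      "\<forall>x. (f has_real_derivative f' x) (at x)" "\<forall>x. (g has_real_derivative g' x) (at x)"
      by blast
    then show ?case
      by (intro bexI[of _ "\<lambda>x. f' x + g' x"]) (auto intro!: derivative_eq_intros generated_algebra.add)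
  next
    case (mult f g)
    then obtain f' g' where "f' \<in> generated_algebra F" "g' \<in> generated_algebra F"
      "\<forall>x. (f has_real_derivative f' x) (at x)" "\<forall>x. (g has_real_derivative g' x) (at x)"
      by blast
    with mult.hyps show ?case
      by (intro bexI[of _ "\<lambda>x. f' x * g x + g' x * f x"])
        (auto intro!: DERIV_mult generated_algebra.add generated_algebra.mult)
  qed
  have "(deriv ^^ n) f \<in> generated_algebra F" for n
  proof (induction n)
    case (Suc n)
    then obtain f' where f': "f' \<in> generated_algebra F"
      "\<forall>x. (((deriv ^^ n) f) has_real_derivative f' x) (at x)"
      using step by blast
    then have "deriv ((deriv ^^ n) f) = f'"
      by (auto intro: DERIV_imp_deriv)
    with f' show ?case by simp
  qed (simp add: f)
  then show ?thesis
    unfolding smooth_def using step real_differentiable_def by blast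
qed

lemma smooth_DERIV: "smooth f \<Longrightarrow> (f has_real_derivative deriv f x) (at x)"
  unfolding smooth_def by (metis DERIV_deriv_iff_real_differentiable funpow_0)

lemma smooth_deriv: "smooth f \<Longrightarrow> smooth (deriv f)"
  unfolding smooth_def by (metis comp_apply funpow_Suc_right)

lemma smooth_if_deriv:
  assumes "\<And>x. (f has_real_derivative f' x) (at x)" "smooth f'"
  shows "smooth f"
proof -
  have "deriv f = f'"
    using assms(1) by (auto intro: DERIV_imp_deriv)
  then have "((deriv ^^ n) f) differentiable (at x)" for n x
    using assms
    by (cases n) (auto simp: smooth_def funpow_Suc_right real_differentiable_def simp del: funpow.simps)
  then show ?thesis by (simp add: smooth_def)
qed

text \<open>The smooth functions themselves are an admissible set of generators, so they form an algebra.\<close>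

lemma smooth_generated_algebra: "f \<in> generated_algebra (Collect smooth) \<Longrightarrow> smooth f"
  by (rule smooth_coinduct[where F="Collect smooth"])
    (auto intro!: bexI[where x="deriv _"] generated_algebra.base smooth_DERIV smooth_deriv)

lemma smooth_const: "smooth (\<lambda>x. c)"
  by (rule smooth_generated_algebra) (rule generated_algebra.const)

lemma smooth_add: "smooth f \<Longrightarrow> smooth g \<Longrightarrow> smooth (\<lambda>x. f x + g x)"
  by (rule smooth_generated_algebra) (simp add: generated_algebra.intros)

lemma smooth_mult: "smooth f \<Longrightarrow> smooth g \<Longrightarrow> smooth (\<lambda>x. f x * g x)"
  by (rule smooth_generated_algebra) (simp add: generated_algebra.intros)

lemma smooth_affine:
  assumes "smooth f"
  shows "smooth (\<lambda>x. f (\<alpha> * x + \<beta>))"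
proof (rule smooth_coinduct[where F="{\<lambda>x. f (\<alpha> * x + \<beta>) | f. smooth f}"])
  fix g assume "g \<in> {\<lambda>x. f (\<alpha> * x + \<beta>) | f. smooth f}"
  then obtain f where f: "smooth f" and g: "g = (\<lambda>x. f (\<alpha> * x + \<beta>))" by auto
  have "(g has_real_derivative deriv f (\<alpha> * x + \<beta>) * \<alpha>) (at x)" for x
    unfolding g
    by (rule DERIV_chain'[where g=f and f="\<lambda>x. \<alpha> * x + \<beta>"])
      (auto intro!: derivative_eq_intros smooth_DERIV f)
  moreover have "(\<lambda>x. deriv f (\<alpha> * x + \<beta>) * \<alpha>) \<in> generated_algebra {\<lambda>x. f (\<alpha> * x + \<beta>) | f. smooth f}"
    by (rule generated_algebra.mult) (use f smooth_deriv in \<open>auto intro!: generated_algebra.intros\<close>)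
  ultimately show "\<exists>g'\<in>generated_algebra {\<lambda>x. f (\<alpha> * x + \<beta>) | f. smooth f}.
      \<forall>x. (g has_real_derivative g' x) (at x)"
    by (intro bexI[of _ "\<lambda>x. deriv f (\<alpha> * x + \<beta>) * \<alpha>"]) auto
qed (use assms in \<open>auto intro!: generated_algebra.base\<close>)

lemma smooth_real_polynomial_function:
  assumes "real_polynomial_function p"
  shows "smooth p"
  using assms
proof induction
  case (linear f)
  then obtain c where "f = (\<lambda>x. x * c)" by (metis real_bounded_linear)
  moreover have "smooth (\<lambda>x. x * c)"
    by (rule smooth_if_deriv[where f'="\<lambda>x. c"]) (auto intro!: derivative_eq_intros smooth_const)
  ultimately show ?case by simp
qed (auto intro: smooth_const smooth_add smooth_mult)

lemma smooth_continuous: "smooth f \<Longrightarrow> continuous_on S f"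
  by (meson DERIV_isCont continuous_at_imp_continuous_on smooth_DERIV)

text \<open>For \<open>k = 0\<close> this is the standard smooth function that vanishes exactly on the nonpositive reals. The
additional powers of \<open>1 / x\<close> make the family closed, up to linear combinations, under differentiation.\<close>

definition flat_exp :: "nat \<Rightarrow> real \<Rightarrow> real" where
  "flat_exp k x = (if x \<le> 0 then 0 else (1 / x) ^ k * exp (- (1 / x)))"

text \<open>Keeping only the term of order \<open>k + 2\<close> in the exponential series of \<open>1 / x\<close> already gives quadratic decay at
the origin, which is what differentiability there requires.\<close>

lemma flat_exp_le:
  assumes "x > 0"
  shows "flat_exp k x \<le> fact (k + 2) * x\<^sup>2"
proof -
  define y where "y = 1 / x"
  have y: "y > 0" "x = 1 / y" using assms by (auto simp: y_def)
  have "y ^ (k + 2) /\<^sub>R fact (k + 2) = (\<Sum>i\<in>{k + 2}. y ^ i /\<^sub>R fact i)"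
    by simp
  also have "\<dots> \<le> (\<Sum>i. y ^ i /\<^sub>R fact i)"
    using y by (intro sum_le_suminf summable_exp_generic) auto
  also have "\<dots> = exp y"
    by (simp add: exp_def)
  finally have "y ^ k * y\<^sup>2 \<le> fact (k + 2) * exp y"
    by (simp add: power_add divide_simps mult.commute power2_eq_square mult.left_commute del: fact_Suc)
  then have "y ^ k * exp (- y) \<le> fact (k + 2) / y\<^sup>2"
    using y by (simp add: exp_minus divide_simps mult.commute del: fact_Suc)
  with assms show ?thesis
    by (simp add: flat_exp_def y_def[symmetric] y(2) power_divide del: fact_Suc)
qed

lemma flat_exp_has_derivative:
  "(flat_exp k has_real_derivative flat_exp (k + 2) x - real k * flat_exp (k + 1) x) (at x)"
proof (cases x "0::real" rule: linorder_cases)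
  case less
  have "((\<lambda>x. 0) has_real_derivative 0) (at x)" by simp
  then have "(flat_exp k has_real_derivative 0) (at x)"
    by (rule has_field_derivative_transform_within_open[of _ _ _ "{..<0}"])
      (use less in \<open>auto simp: flat_exp_def\<close>)
  with less show ?thesis by (simp add: flat_exp_def)
next
  case greater
  have "((\<lambda>x. (1 / x) ^ k * exp (- (1 / x))) has_real_derivative
      flat_exp (k + 2) x - real k * flat_exp (k + 1) x) (at x)"
  proof -
    have inv: "((\<lambda>x. 1 / x) has_real_derivative - ((1 / x)\<^sup>2)) (at x)"
      using greater by (auto intro!: derivative_eq_intros simp: power2_eq_square)
    have pow: "((\<lambda>x. (1 / x) ^ k) has_real_derivative - real k * (1 / x) ^ (k + 1)) (at x)"
    proof (cases k)
      case (Suc m)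
      have "(1 + real m) * (- (y\<^sup>2) * y ^ m) = - real (Suc m) * y ^ (Suc m + 1)" for y :: real
        unfolding of_nat_Suc power2_eq_square power_Suc power_add by (simp add: algebra_simps)
      then show ?thesis
        unfolding Suc by (rule DERIV_cong[OF DERIV_power_Suc[OF inv]])
    qed simp
    have "((\<lambda>x. exp (- (1 / x))) has_real_derivative exp (- (1 / x)) * (1 / x)\<^sup>2) (at x)"
      using DERIV_fun_exp[OF DERIV_minus[OF inv]] by simp
    from DERIV_mult[OF pow this] show ?thesis
      using greater
      by (simp add: flat_exp_def power_add power2_eq_square algebra_simps)
  qed
  then show ?thesis
    by (rule has_field_derivative_transform_within_open[of _ _ _ "{0<..}"])
      (use greater in \<open>auto simp: flat_exp_def\<close>)
next
  case equal
  have "((\<lambda>h. (flat_exp k (0 + h) - flat_exp k 0) / h) \<longlongrightarrow> 0) (at 0)"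
  proof (rule Lim_null_comparison)
    show "((\<lambda>h. fact (k + 2) * \<bar>h\<bar>) \<longlongrightarrow> (0::real)) (at 0)"
      by (auto intro!: tendsto_eq_intros)
    have "norm ((flat_exp k (0 + h) - flat_exp k 0) / h) \<le> fact (k + 2) * \<bar>h\<bar>" for h
    proof (cases "h > 0")
      case True
      have "flat_exp k h \<ge> 0" by (simp add: flat_exp_def)
      then show ?thesis
        using flat_exp_le[OF True, of k] True
        by (simp add: flat_exp_def[of _ 0] field_simps power2_eq_square)
    next
      case False
      then have "flat_exp k (0 + h) = 0" "flat_exp k 0 = 0" by (auto simp: flat_exp_def)
      then show ?thesis
        using mult_nonneg_nonneg[OF fact_ge_zero[of "k + 2", where 'a=real] abs_ge_zero[of h]]
        by (simp del: fact_Suc)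
    qed
    then show "\<forall>\<^sub>F h in at 0. norm ((flat_exp k (0 + h) - flat_exp k 0) / h) \<le> fact (k + 2) * \<bar>h\<bar>"
      by simp
  qed
  with equal show ?thesis by (simp add: DERIV_def flat_exp_def[of _ 0])
qed

lemma smooth_flat_exp: "smooth (flat_exp k)"
proof (rule smooth_coinduct[where F="range flat_exp"])
  fix f assume "f \<in> range flat_exp"
  then obtain k where f: "f = flat_exp k" by auto
  have "(\<lambda>x. flat_exp (k + 2) x + (- real k) * flat_exp (k + 1) x) \<in> generated_algebra (range flat_exp)"
    by (intro generated_algebra.intros) auto
  then show "\<exists>f'\<in>generated_algebra (range flat_exp). \<forall>x. (f has_real_derivative f' x) (at x)"
    using flat_exp_has_derivative[of k] by (intro bexI) (auto simp: f)
qed (simp add: generated_algebra.base)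

text \<open>A compact subset of the open interval lies in a compact subinterval; this form of the support condition
is easier to combine and to integrate.\<close>

lemma test_function_iff:
  assumes "a < b"
  shows "test_function a b \<phi> \<longleftrightarrow>
    smooth \<phi> \<and> (\<exists>c d. a < c \<and> c \<le> d \<and> d < b \<and> (\<forall>x. x \<notin> {c..d} \<longrightarrow> \<phi> x = 0))"
proof -
  have "\<exists>c d. a < c \<and> c \<le> d \<and> d < b \<and> K \<subseteq> {c..d}" if K: "compact K" "K \<subseteq> {a<..<b}" for K
  proof (cases "K = {}")
    case True
    with \<open>a < b\<close> dense[of a b] show ?thesis by auto
  next
    case False
    with K obtain c d where "c \<in> K" "d \<in> K" "\<And>x. x \<in> K \<Longrightarrow> c \<le> x" "\<And>x. x \<in> K \<Longrightarrow> x \<le> d"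
      by (metis compact_attains_inf compact_attains_sup)
    with K(2) show ?thesis by (intro exI[of _ c] exI[of _ d]) auto
  qed
  moreover have "compact {c..d} \<and> {c..d} \<subseteq> {a<..<b}" if "a < c" "d < b" for c d :: real
    using that by auto
  ultimately have "(\<exists>K. compact K \<and> K \<subseteq> {a<..<b} \<and> (\<forall>x. x \<notin> K \<longrightarrow> \<phi> x = 0)) \<longleftrightarrow>
      (\<exists>c d. a < c \<and> c \<le> d \<and> d < b \<and> (\<forall>x. x \<notin> {c..d} \<longrightarrow> \<phi> x = 0))" (is "?K \<longleftrightarrow> ?I")
    by (smt (verit, ccfv_threshold) subset_iff)
  then show ?thesis
    by (simp add: test_function_def smooth_def)
qed

text \<open>Test functions that increase to the indicator of the whole interval: since \<open>exp (- (1 / t))\<close> tends to 1 as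
\<open>t\<close> tends to infinity, speeding up the argument flattens the function to 1 on the inside. The shift by 1
moves the support to \<open>[a + 1 / (n + 1), b - 1 / (n + 1)]\<close>, away from the end points.\<close>

definition plateau :: "real \<Rightarrow> real \<Rightarrow> nat \<Rightarrow> real \<Rightarrow> real" where
  "plateau a b n x = flat_exp 0 (real (n + 1) * (x - a) - 1) * flat_exp 0 (real (n + 1) * (b - x) - 1)"

lemma test_function_times_plateau:
  assumes "a < b" and f: "smooth f"
  shows "test_function a b (\<lambda>x. f x * plateau a b n x)"
proof -
  define N where "N = real (n + 1)"
  have N: "N > 0" by (simp add: N_def)
  have "smooth (\<lambda>x. flat_exp 0 (N * x + (- N * a - 1)) * flat_exp 0 ((- N) * x + (N * b - 1)))"
    by (intro smooth_mult smooth_affine smooth_flat_exp)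
  then have "smooth (\<lambda>x. f x * plateau a b n x)"
    by (intro smooth_mult f) (simp add: plateau_def N_def algebra_simps)
  moreover have "plateau a b n x = 0" if "x \<notin> {a + 1 / N..b - 1 / N}" for x
  proof -
    have "N * (x - a) - 1 \<le> 0 \<or> N * (b - x) - 1 \<le> 0"
      using that N by (auto simp: field_simps)
    then show ?thesis
      unfolding plateau_def N_def[symmetric] by (auto simp: flat_exp_def)
  qed
  moreover have "\<exists>c d. a < c \<and> c \<le> d \<and> d < b \<and> (\<forall>x. x \<notin> {c..d} \<longrightarrow> x \<notin> {a + 1 / N..b - 1 / N})"
  proof (cases "a + 1 / N \<le> b - 1 / N")
    case True
    with N show ?thesis by (intro exI[of _ "a + 1 / N"] exI[of _ "b - 1 / N"]) auto
  next
    case False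
    with dense[OF \<open>a < b\<close>] show ?thesis by force
  qed
  ultimately show ?thesis
    unfolding test_function_iff[OF \<open>a < b\<close>] by (metis mult_zero_right)
qed

lemma plateau_bounds: "0 \<le> plateau a b n x" "plateau a b n x \<le> 1"
proof -
  have "0 \<le> flat_exp 0 y \<and> flat_exp 0 y \<le> 1" for y by (simp add: flat_exp_def)
  then show "0 \<le> plateau a b n x" "plateau a b n x \<le> 1"
    by (auto simp: plateau_def intro: mult_le_one)
qed

lemma plateau_tendsto:
  assumes "a < x" "x < b"
  shows "(\<lambda>n. plateau a b n x) \<longlonglongrightarrow> 1"
proof -
  have "(\<lambda>n. flat_exp 0 (real (n + 1) * t - 1)) \<longlonglongrightarrow> 1" if "t > 0" for t
  proof -
    have lim: "filterlim (\<lambda>n. real (n + 1) * t - 1) at_top sequentially"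
      using that by real_asymp
    have "(\<lambda>n. exp (- inverse (real (n + 1) * t - 1))) \<longlonglongrightarrow> exp (- 0)"
      by (intro tendsto_intros tendsto_inverse_0_at_top lim)
    moreover have "\<forall>\<^sub>F n in sequentially. exp (- inverse (real (n + 1) * t - 1)) = flat_exp 0 (real (n + 1) * t - 1)"
      using spec[OF lim[unfolded filterlim_at_top_dense], of 0]
      by eventually_elim (simp add: flat_exp_def inverse_eq_divide)
    ultimately show ?thesis by (simp add: tendsto_cong)
  qed
  then have "(\<lambda>n. plateau a b n x) \<longlonglongrightarrow> 1 * 1"
    unfolding plateau_def using assms by (intro tendsto_mult) auto
  then show ?thesis by simp
qed

section \<open>Square-integrable functions on a bounded interval\<close>

lemma finite_measure_interval: "finite_measure (lebesgue_on {a<..<b::real})"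
  by (rule finite_measure_lebesgue_on) (auto intro: bounded_set_imp_lmeasurable)

lemma measure_interval: "a < b \<Longrightarrow> measure (lebesgue_on {a<..<b}) {a<..<b} = b - (a::real)"
  by (subst measure_restrict_space) auto

lemma integrable_const_interval [simp]: "integrable (lebesgue_on {a<..<b::real}) (\<lambda>x. c :: 'a :: {banach, second_countable_topology})"
  using finite_measure_interval finite_measure.integrable_const by blast

lemma integral_const_interval:
  "a < b \<Longrightarrow> (LINT x|lebesgue_on {a<..<b::real}. c) = (b - a) *\<^sub>R (c :: 'a :: {banach, second_countable_topology})"
  by (simp add: measure_interval)

lemma integrable_interval_bounded:
  fixes f :: "real \<Rightarrow> 'a::{banach, second_countable_topology}"
  assumes "f \<in> borel_measurable (lebesgue_on {a<..<b})" "\<And>x. x \<in> {a<..<b} \<Longrightarrow> norm (f x) \<le> K"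
  shows "integrable (lebesgue_on {a<..<b}) f"
proof (rule Bochner_Integration.integrable_bound[OF integrable_const_interval[of a b K]])
  show "AE x in lebesgue_on {a<..<b}. norm (f x) \<le> norm K"
    using order_trans[OF assms(2) abs_ge_self] by (intro AE_I2) simp
qed (rule assms)

lemma continuous_measurable_interval:
  fixes f :: "real \<Rightarrow> 'a::{banach, second_countable_topology}"
  assumes "continuous_on {a..b} f"
  shows "f \<in> borel_measurable (lebesgue_on {a<..<b})"
  by (rule continuous_imp_measurable_on_sets_lebesgue)
    (use assms in \<open>auto elim: continuous_on_subset\<close>)

lemma continuous_bounded_interval:
  fixes f :: "real \<Rightarrow> 'a::real_normed_vector"
  assumes "continuous_on {a..b} f"
  obtains K where "K \<ge> 0" "\<And>x. x \<in> {a..b} \<Longrightarrow> norm (f x) \<le> K"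
proof -
  have "bounded (f ` {a..b})"
    by (intro compact_imp_bounded compact_continuous_image assms) auto
  then obtain K where "\<forall>x\<in>{a..b}. norm (f x) \<le> K" by (auto simp: bounded_iff)
  then show ?thesis by (intro that[of "max K 0"]) (auto intro: max.coboundedI1)
qed

lemma integrable_interval_continuous:
  fixes f :: "real \<Rightarrow> 'a::{banach, second_countable_topology}"
  assumes "continuous_on {a..b} f"
  shows "integrable (lebesgue_on {a<..<b}) f"
proof -
  obtain K where "\<And>x. x \<in> {a..b} \<Longrightarrow> norm (f x) \<le> K"
    using continuous_bounded_interval[OF assms] by blast
  then show ?thesis
    by (intro integrable_interval_bounded[where K=K] continuous_measurable_interval assms) auto
qed

lemma L2_bounded:
  assumes "u \<in> borel_measurable (lebesgue_on {a<..<b})" "\<And>x. x \<in> {a<..<b} \<Longrightarrow> norm (u x) \<le> K"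
  shows "u \<in> L2 a b"
  unfolding L2_def
  using assms
  by (auto intro!: integrable_interval_bounded[where K="K\<^sup>2"] power_mono)

lemma L2_continuous: "continuous_on {a..b} u \<Longrightarrow> u \<in> L2 a b"
proof -
  assume u: "continuous_on {a..b} u"
  then obtain K where "\<And>x. x \<in> {a..b} \<Longrightarrow> norm (u x) \<le> K"
    using continuous_bounded_interval by blast
  with u show ?thesis
    by (intro L2_bounded[where K=K] continuous_measurable_interval) auto
qed

lemma L2_add:
  assumes "u \<in> L2 a b" "v \<in> L2 a b"
  shows "(\<lambda>x. u x + v x) \<in> L2 a b"
proof -
  have le: "(norm (u x + v x))\<^sup>2 \<le> 2 * (norm (u x))\<^sup>2 + 2 * (norm (v x))\<^sup>2" for x
  proof -
    have "(norm (u x + v x))\<^sup>2 \<le> (norm (u x) + norm (v x))\<^sup>2"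
      by (intro power_mono norm_triangle_ineq) auto
    also have "\<dots> \<le> 2 * (norm (u x))\<^sup>2 + 2 * (norm (v x))\<^sup>2"
      using sum_squares_bound[of "norm (u x)" "norm (v x)"] by (simp add: power2_sum)
    finally show ?thesis .
  qed
  have "integrable (lebesgue_on {a<..<b}) (\<lambda>x. 2 * (norm (u x))\<^sup>2 + 2 * (norm (v x))\<^sup>2)"
    using assms by (auto simp: L2_def)
  then have "integrable (lebesgue_on {a<..<b}) (\<lambda>x. (norm (u x + v x))\<^sup>2)"
  proof (rule Bochner_Integration.integrable_bound)
    show "AE x in lebesgue_on {a<..<b}. norm ((norm (u x + v x))\<^sup>2) \<le> norm (2 * (norm (u x))\<^sup>2 + 2 * (norm (v x))\<^sup>2)"
      using le by (intro AE_I2) simp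
  qed (use assms in \<open>auto simp: L2_def\<close>)
  with assms show ?thesis by (auto simp: L2_def)
qed

lemma L2_cmult: "u \<in> L2 a b \<Longrightarrow> (\<lambda>x. c * u x) \<in> L2 a b"
  by (auto simp: L2_def norm_mult power_mult_distrib)

lemma L2_diff:
  assumes "u \<in> L2 a b" "v \<in> L2 a b"
  shows "(\<lambda>x. u x - v x) \<in> L2 a b"
  using L2_add[OF assms(1) L2_cmult[OF assms(2), of "-1"]] by simp

lemma L2_norm_AE_cong:
  assumes "u \<in> L2 a b" "v \<in> L2 a b" "AE x in lebesgue_on {a<..<b}. u x = v x"
  shows "L2_norm a b u = L2_norm a b v"
  unfolding L2_norm_def
  using assms by (intro arg_cong[where f=sqrt] integral_cong_AE) (auto simp: L2_def)

lemma L2_integrable: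
  assumes "u \<in> L2 a b"
  shows "integrable (lebesgue_on {a<..<b}) u"
proof -
  have "integrable (lebesgue_on {a<..<b}) (\<lambda>x. norm (u x))"
    by (rule finite_measure.square_integrable_imp_integrable[OF finite_measure_interval])
      (use assms in \<open>auto simp: L2_def\<close>)
  then show ?thesis
    by (rule integrable_norm_cancel) (use assms in \<open>auto simp: L2_def\<close>)
qed

text \<open>The Cauchy-Schwarz inequality against the constant function 1, obtained from the nonnegativity of the
variance of \<open>norm u\<close>.\<close>

lemma L1_norm_le_L2_norm:
  assumes "a < b" and u: "u \<in> L2 a b"
  shows "(LINT x|lebesgue_on {a<..<b}. norm (u x)) \<le> sqrt (b - a) * L2_norm a b u"
proof -
  let ?M = "lebesgue_on {a<..<b}"
  define I where "I = (LINT x|?M. norm (u x))"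
  define m where "m = I / (b - a)"
  have [simp]: "integrable ?M (\<lambda>x. norm (u x))" "integrable ?M (\<lambda>x. (norm (u x))\<^sup>2)"
    using L2_integrable[OF u] u by (auto simp: L2_def)
  have "0 \<le> (LINT x|?M. (norm (u x) - m)\<^sup>2)"
    by (rule Bochner_Integration.integral_nonneg) auto
  also have "\<dots> = (LINT x|?M. (norm (u x))\<^sup>2 - 2 * m * norm (u x) + m\<^sup>2)"
    by (simp add: power2_diff algebra_simps)
  also have "\<dots> = (LINT x|?M. (norm (u x))\<^sup>2) - 2 * m * I + (b - a) * m\<^sup>2"
    using \<open>a < b\<close> by (simp add: I_def measure_interval)
  also have "\<dots> = (LINT x|?M. (norm (u x))\<^sup>2) - I\<^sup>2 / (b - a)"
    using \<open>a < b\<close> by (simp add: m_def power2_eq_square)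
  finally have "I\<^sup>2 \<le> (b - a) * (LINT x|?M. (norm (u x))\<^sup>2)"
    using \<open>a < b\<close> by (simp add: field_simps)
  then show ?thesis
    unfolding L2_norm_def I_def[symmetric] real_sqrt_mult[symmetric] by (rule real_le_rsqrt)
qed

lemma L2_norm_bounded:
  assumes "a < b" "u \<in> L2 a b" "K \<ge> 0"
    and "AE x in lebesgue_on {a<..<b}. norm (u x) \<le> K"
  shows "L2_norm a b u \<le> sqrt (b - a) * K"
proof -
  have "(LINT x|lebesgue_on {a<..<b}. (norm (u x))\<^sup>2) \<le> (LINT x|lebesgue_on {a<..<b}. K\<^sup>2)"
    by (rule integral_mono_AE) (use assms in \<open>auto simp: L2_def elim!: eventually_mono intro!: power_mono\<close>)
  also have "\<dots> = (b - a) * K\<^sup>2"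
    using \<open>a < b\<close> by (simp add: measure_interval)
  finally have "L2_norm a b u \<le> sqrt ((b - a) * K\<^sup>2)"
    unfolding L2_norm_def by (rule real_sqrt_le_mono)
  with \<open>K \<ge> 0\<close> show ?thesis by (simp add: real_sqrt_mult)
qed

text \<open>Measurable functions are almost everywhere limits of continuous ones. Composing the approximants with the
nearest-point projection onto a ball keeps them bounded by the bound of the limit and does not move the
limit, so that dominated convergence applies.\<close>

lemma continuous_approx_of_bounded_measurable:
  fixes h :: "real \<Rightarrow> 'b::euclidean_space"
  assumes "h \<in> borel_measurable (lebesgue_on S)" "S \<in> sets lebesgue"
    and K: "\<And>x. x \<in> S \<Longrightarrow> norm (h x) \<le> K" "K \<ge> 0"
  obtains g where "\<And>n::nat. continuous_on UNIV (g n)" "\<And>n x. norm (g n x) \<le> K"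
    "AE x in lebesgue_on S. (\<lambda>n. g n x) \<longlonglongrightarrow> h x"
proof -
  have "h measurable_on S"
    using assms measurable_on_iff_borel_measurable by blast
  then obtain N f where N: "negligible N" and f: "\<And>n::nat. continuous_on UNIV (f n)"
    and lim: "\<And>x. x \<notin> N \<Longrightarrow> (\<lambda>n. f n x) \<longlonglongrightarrow> (if x \<in> S then h x else 0)"
    unfolding measurable_on_def by blast
  define clip :: "'b \<Rightarrow> 'b" where "clip = closest_point (cball 0 K)"
  have cont: "continuous_on UNIV clip"
    unfolding clip_def by (rule continuous_on_closest_point) (use K in auto)
  show ?thesis
  proof
    show "continuous_on UNIV (\<lambda>x. clip (f n x))" for n
      using continuous_on_compose2[OF cont f] by auto
    show "norm (clip (f n x)) \<le> K" for n x
      using closest_point_in_set[of "cball 0 K" "f n x"] K(2) by (auto simp: clip_def)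
    have "(\<lambda>n. clip (f n x)) \<longlonglongrightarrow> h x" if "x \<in> S" "x \<notin> N" for x
    proof -
      have "(\<lambda>n. clip (f n x)) \<longlonglongrightarrow> clip (h x)"
        using lim[of x] that by (intro continuous_on_tendsto_compose[OF cont]) auto
      moreover have "clip (h x) = h x"
        unfolding clip_def using K(1)[OF that(1)] by (intro closest_point_self) auto
      ultimately show ?thesis by simp
    qed
    moreover have "AE x in lebesgue. x \<notin> N"
      using N negligible_iff_null_sets AE_not_in by blast
    ultimately show "AE x in lebesgue_on S. (\<lambda>n. clip (f n x)) \<longlonglongrightarrow> h x"
      using assms(2) by (subst AE_restrict_space_iff) (auto elim!: eventually_mono)
  qed
qed

section \<open>The fundamental lemma of the calculus of variations\<close>

lemma integrable_scaleR_bounded: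
  fixes w :: "real \<Rightarrow> complex"
  assumes w: "integrable (lebesgue_on {a<..<b}) w"
    and g: "g \<in> borel_measurable (lebesgue_on {a<..<b})" "\<And>x. x \<in> {a<..<b} \<Longrightarrow> \<bar>g x\<bar> \<le> K"
  shows "integrable (lebesgue_on {a<..<b}) (\<lambda>x. g x *\<^sub>R w x)"
proof (rule Bochner_Integration.integrable_bound)
  show "integrable (lebesgue_on {a<..<b}) (\<lambda>x. K * norm (w x))" using w by simp
  show "AE x in lebesgue_on {a<..<b}. norm (g x *\<^sub>R w x) \<le> norm (K * norm (w x))"
    using order_trans[OF g(2) abs_ge_self] by (intro AE_I2) (simp add: abs_mult mult_right_mono)
qed (use w g in auto)

lemma integrable_scaleR_continuous:
  fixes w :: "real \<Rightarrow> complex"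
  assumes "integrable (lebesgue_on {a<..<b}) w" "continuous_on {a..b} g"
  shows "integrable (lebesgue_on {a<..<b}) (\<lambda>x. g x *\<^sub>R w x)"
proof -
  obtain K where "\<And>x. x \<in> {a..b} \<Longrightarrow> norm (g x) \<le> K"
    using continuous_bounded_interval[OF assms(2)] by blast
  then show ?thesis
    by (intro integrable_scaleR_bounded[where K=K] assms(1) continuous_measurable_interval assms(2)) auto
qed

text \<open>If \<open>w\<close> annihilates all test functions, it annihilates ever larger classes: smooth functions (multiply by
plateaus and pass to the limit), continuous functions (Weierstrass approximation by polynomials), and
indicators of measurable sets (approximation by bounded continuous functions). The last class forces
\<open>w = 0\<close> almost everywhere.\<close>

lemma fundamental_lemma_of_variations:
  fixes w :: "real \<Rightarrow> complex"
  assumes "a < b" and w: "integrable (lebesgue_on {a<..<b}) w"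
    and test: "\<And>\<phi>. test_function a b \<phi> \<Longrightarrow> (LINT x|lebesgue_on {a<..<b}. \<phi> x *\<^sub>R w x) = 0"
  shows "AE x in lebesgue_on {a<..<b}. w x = 0"
proof -
  let ?M = "lebesgue_on {a<..<b}"
  have w_meas [measurable]: "w \<in> borel_measurable ?M" using w by auto
  have smooth0: "(LINT x|?M. p x *\<^sub>R w x) = 0" if "smooth p" for p
  proof -
    have p: "continuous_on {a..b} p" using that by (rule smooth_continuous)
    have "(\<lambda>n. LINT x|?M. (p x * plateau a b n x) *\<^sub>R w x) \<longlonglongrightarrow> (LINT x|?M. p x *\<^sub>R w x)"
    proof (rule integral_dominated_convergence)
      show "integrable ?M (\<lambda>x. norm (p x *\<^sub>R w x))"
        by (intro integrable_norm integrable_scaleR_continuous w p)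
      show "(\<lambda>x. (p x * plateau a b n x) *\<^sub>R w x) \<in> borel_measurable ?M" for n
        by (intro borel_measurable_integrable integrable_scaleR_continuous w smooth_continuous)
          (use test_function_times_plateau[OF \<open>a < b\<close> that] test_function_iff[OF \<open>a < b\<close>] in blast)
      show "(\<lambda>x. p x *\<^sub>R w x) \<in> borel_measurable ?M"
        by (intro borel_measurable_integrable integrable_scaleR_continuous w p)
      show "AE x in ?M. (\<lambda>n. (p x * plateau a b n x) *\<^sub>R w x) \<longlonglongrightarrow> p x *\<^sub>R w x"
      proof (rule AE_I2)
        fix x assume "x \<in> space ?M"
        then have "(\<lambda>n. (p x * plateau a b n x) *\<^sub>R w x) \<longlonglongrightarrow> (p x * 1) *\<^sub>R w x"
          by (intro tendsto_intros plateau_tendsto) auto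
        then show "(\<lambda>n. (p x * plateau a b n x) *\<^sub>R w x) \<longlonglongrightarrow> p x *\<^sub>R w x" by simp
      qed
      show "AE x in ?M. norm ((p x * plateau a b n x) *\<^sub>R w x) \<le> norm (p x *\<^sub>R w x)" for n
        using plateau_bounds
        by (intro AE_I2) (auto simp: abs_mult intro!: mult_right_mono mult_left_le)
    qed
    then show ?thesis
      using test[OF test_function_times_plateau[OF \<open>a < b\<close> that]] by (simp add: LIMSEQ_const_iff)
  qed
  have continuous0: "(LINT x|?M. g x *\<^sub>R w x) = 0" if g: "continuous_on {a..b} g" for g
  proof -
    have bound: "norm (LINT x|?M. g x *\<^sub>R w x) \<le> e * (LINT x|?M. norm (w x))" if "e > 0" for e
    proof -
      obtain p where p: "real_polynomial_function p" "\<And>x. x \<in> {a..b} \<Longrightarrow> \<bar>g x - p x\<bar> < e"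
        using Stone_Weierstrass_real_polynomial_function[OF _ g \<open>e > 0\<close>] by auto
      have "smooth p" using p(1) by (rule smooth_real_polynomial_function)
      then have "(LINT x|?M. g x *\<^sub>R w x) = (LINT x|?M. (g x - p x) *\<^sub>R w x)"
        using smooth0[of p]
          integrable_scaleR_continuous[OF w g]
          integrable_scaleR_continuous[OF w smooth_continuous[of p]]
        by (simp add: scaleR_diff_left)
      also have "norm \<dots> \<le> (LINT x|?M. e * norm (w x))"
      proof (rule order_trans[OF integral_norm_bound integral_mono])
        show "integrable ?M (\<lambda>x. norm ((g x - p x) *\<^sub>R w x))"
          by (intro integrable_norm integrable_scaleR_continuous w continuous_on_diff g
              smooth_continuous[OF \<open>smooth p\<close>])
        show "integrable ?M (\<lambda>x. e * norm (w x))" using w by simp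
        show "norm ((g x - p x) *\<^sub>R w x) \<le> e * norm (w x)" if "x \<in> space ?M" for x
          using p(2)[of x] that by (auto intro!: mult_right_mono)
      qed
      finally show ?thesis by simp
    qed
    have "((\<lambda>e. e * (LINT x|?M. norm (w x))) \<longlongrightarrow> 0 * (LINT x|?M. norm (w x))) (at_right 0)"
      by (intro tendsto_intros)
    then have "norm (LINT x|?M. g x *\<^sub>R w x) \<le> 0 * (LINT x|?M. norm (w x))"
      by (rule tendsto_lowerbound) (auto simp: eventually_at_filter bound intro!: always_eventually)
    then show ?thesis by simp
  qed
  show ?thesis
  proof (rule sigma_finite_measure.density_zero[OF finite_measure.axioms(1)[OF finite_measure_interval] w])
    fix A assume A: "A \<in> sets ?M"
    have "indicat_real A \<in> borel_measurable ?M" using A by simp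
    then obtain g where g: "\<And>n::nat. continuous_on UNIV (g n)" "\<And>n x. norm (g n x) \<le> 1"
      "AE x in ?M. (\<lambda>n. g n x) \<longlonglongrightarrow> indicat_real A x"
      by (rule continuous_approx_of_bounded_measurable[where K=1]) (auto simp: indicator_def)
    have gc: "continuous_on {a..b} (g n)" for n
      using g(1) continuous_on_subset by blast
    have "(\<lambda>n. LINT x|?M. g n x *\<^sub>R w x) \<longlonglongrightarrow> (LINT x|?M. indicat_real A x *\<^sub>R w x)"
    proof (rule integral_dominated_convergence)
      show "integrable ?M (\<lambda>x. norm (w x))" using w by simp
      show "(\<lambda>x. indicat_real A x *\<^sub>R w x) \<in> borel_measurable ?M" using A by measurable
      show "(\<lambda>x. g n x *\<^sub>R w x) \<in> borel_measurable ?M" for n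
        by (intro borel_measurable_integrable integrable_scaleR_continuous w gc)
      show "AE x in ?M. (\<lambda>n. g n x *\<^sub>R w x) \<longlonglongrightarrow> indicat_real A x *\<^sub>R w x"
        using g(3) by eventually_elim (intro tendsto_intros)
      show "AE x in ?M. norm (g n x *\<^sub>R w x) \<le> norm (w x)" for n
        using g(2) by (intro AE_I2) (auto intro!: mult_left_le_one_le)
    qed
    then show "set_lebesgue_integral ?M A w = 0"
      using continuous0[OF gc] by (simp add: set_lebesgue_integral_def LIMSEQ_const_iff)
  qed
qed

section \<open>Primitives and weak derivatives\<close>

lemma measurable_ident_lebesgue_on [measurable]: "(\<lambda>x::real. x) \<in> borel_measurable (lebesgue_on S)"
  using id_borel_measurable_lebesgue_on[of S] by (simp add: id_def)

text \<open>The primitive as an integral over the fixed domain \<open>(a, b)\<close>, with the variable limit moved into the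
integrand. This is the form to which Fubini's theorem applies.\<close>

lemma integral_below_eq_primitive:
  fixes w :: "real \<Rightarrow> 'b::euclidean_space"
  assumes w: "integrable (lebesgue_on {a<..<b}) w" and s: "s \<in> {a..b}"
  shows "(LINT t|lebesgue_on {a<..<b}. indicat_real {..<s} t *\<^sub>R w t) = integral {a..s} w"
proof -
  have "indicat_real {..<s} \<in> borel_measurable (lebesgue_on {a<..<b})" by measurable
  then have "integrable (lebesgue_on {a<..<b}) (\<lambda>t. indicat_real {..<s} t *\<^sub>R w t)"
    by (intro Bochner_Integration.integrable_bound[OF w]) (use w in \<open>auto simp: indicator_def\<close>)
  then have "(LINT t|lebesgue_on {a<..<b}. indicat_real {..<s} t *\<^sub>R w t) =
      integral {a<..<b} (\<lambda>t. if t \<in> {..<s} then w t else 0)"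
    by (subst lebesgue_integral_eq_integral) (auto simp: indicator_scaleR_eq_if)
  also have "\<dots> = integral ({..<s} \<inter> {a<..<b}) w"
    by (rule Henstock_Kurzweil_Integration.integral_restrict_Int)
  also have "{..<s} \<inter> {a<..<b} = {a<..<s}" using s by auto
  finally show ?thesis by (simp add: integral_open_interval_real)
qed

lemma primitive_diff_le:
  fixes w :: "real \<Rightarrow> 'b::euclidean_space"
  assumes w: "integrable (lebesgue_on {a<..<b}) w" and s: "s \<in> {a..b}" "t \<in> {a..b}"
  shows "norm (integral {a..s} w - integral {a..t} w) \<le> (LINT x|lebesgue_on {a<..<b}. norm (w x))"
proof -
  let ?M = "lebesgue_on {a<..<b}"
  have int: "integrable ?M (\<lambda>x. indicat_real {..<r} x *\<^sub>R w x)" for r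
  proof -
    have "indicat_real {..<r} \<in> borel_measurable ?M" by measurable
    then show ?thesis
      by (intro Bochner_Integration.integrable_bound[OF w]) (use w in \<open>auto simp: indicator_def\<close>)
  qed
  have "integral {a..s} w - integral {a..t} w =
      (LINT x|?M. indicat_real {..<s} x *\<^sub>R w x - indicat_real {..<t} x *\<^sub>R w x)"
    using integral_below_eq_primitive[OF w s(1)] integral_below_eq_primitive[OF w s(2)] int
    by (simp only: Bochner_Integration.integral_diff)
  also have "norm \<dots> \<le> (LINT x|?M. norm (w x))"
    by (rule order_trans[OF integral_norm_bound integral_mono])
      (use int w in \<open>auto simp: indicator_def intro!: integrable_norm Bochner_Integration.integrable_diff\<close>)
  finally show ?thesis .
qed

lemma primitive_continuous:
  fixes w :: "real \<Rightarrow> 'b::euclidean_space"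
  assumes "integrable (lebesgue_on {a<..<b}) w"
  shows "continuous_on {a..b} (\<lambda>x. integral {a..x} w)"
  by (intro indefinite_integral_continuous_1)
    (use integrable_on_lebesgue_on[OF assms] in \<open>simp add: integrable_on_open_interval_real\<close>)

lemma integral_deriv_above:
  assumes "a < b" "test_function a b \<phi>" "s \<in> {a..b}"
  shows "(LINT t|lebesgue_on {a<..<b}. indicat_real {s<..} t * deriv \<phi> t) = - \<phi> s"
proof -
  have \<phi>: "smooth \<phi>" and "\<phi> b = 0"
    using assms(2) unfolding test_function_iff[OF \<open>a < b\<close>] by auto
  have cont: "continuous_on S (deriv \<phi>)" for S
    by (intro smooth_continuous smooth_deriv \<phi>)
  have int: "integrable (lebesgue_on {a<..<b}) (deriv \<phi>)"
    by (rule integrable_interval_continuous[OF cont])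
  have "indicat_real {s<..} \<in> borel_measurable (lebesgue_on {a<..<b})" by measurable
  then have "integrable (lebesgue_on {a<..<b}) (\<lambda>t. indicat_real {s<..} t * deriv \<phi> t)"
    by (intro Bochner_Integration.integrable_bound[OF int]) (use int in \<open>auto simp: indicator_def\<close>)
  then have "(LINT t|lebesgue_on {a<..<b}. indicat_real {s<..} t * deriv \<phi> t) =
      integral {a<..<b} (\<lambda>t. if t \<in> {s<..} then deriv \<phi> t else 0)"
    by (subst lebesgue_integral_eq_integral) (auto simp: indicator_def intro!: arg_cong[where f="integral _"])
  also have "\<dots> = integral ({s<..} \<inter> {a<..<b}) (deriv \<phi>)"
    by (rule Henstock_Kurzweil_Integration.integral_restrict_Int)
  also have "{s<..} \<inter> {a<..<b} = {s<..<b}" using assms(3) by auto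
  also have "integral {s<..<b} (deriv \<phi>) = integral {s..b} (deriv \<phi>)"
    by (simp add: integral_open_interval_real)
  also have "\<dots> = \<phi> b - \<phi> s"
    using assms(3)
    by (intro integral_unique fundamental_theorem_of_calculus)
      (auto intro!: has_field_derivative_at_within smooth_DERIV[OF \<phi>]
        simp flip: has_real_derivative_iff_has_vector_derivative)
  finally show ?thesis using \<open>\<phi> b = 0\<close> by simp
qed

text \<open>Primitives of merely integrable functions need not be differentiable everywhere, so integration by parts is
replaced by Fubini's theorem for the integrand \<open>deriv \<phi> x * w t\<close> on the triangle \<open>t < x\<close>: integrating
first over \<open>t\<close> yields the primitive of \<open>w\<close>, integrating first over \<open>x\<close> yields \<open>- \<phi> t\<close>.\<close>

lemma primitive_has_weak_deriv:
  fixes w :: "real \<Rightarrow> complex"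
  assumes "a < b" and w: "integrable (lebesgue_on {a<..<b}) w"
  shows "has_weak_deriv a b (\<lambda>x. c + integral {a..x} w) w"
  unfolding has_weak_deriv_def
proof (intro allI impI)
  fix \<phi> assume test: "test_function a b \<phi>"
  let ?M = "lebesgue_on {a<..<b}"
  interpret finite_measure ?M by (rule finite_measure_interval)
  interpret pair_sigma_finite ?M ?M ..
  have \<phi>: "smooth \<phi>" and "\<phi> a = 0"
    using test unfolding test_function_iff[OF \<open>a < b\<close>] by auto
  have D: "continuous_on S (deriv \<phi>)" for S
    by (intro smooth_continuous smooth_deriv \<phi>)
  obtain K where K: "K \<ge> 0" "\<And>x. x \<in> {a..b} \<Longrightarrow> norm (deriv \<phi> x) \<le> K"
    using continuous_bounded_interval[OF D] by blast
  define f where "f = (\<lambda>x t. (if t < x then deriv \<phi> x else 0) *\<^sub>R w t)"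
  have [measurable]: "w \<in> borel_measurable ?M" "deriv \<phi> \<in> borel_measurable ?M"
    using w continuous_measurable_interval[OF D] by auto
  have "(\<lambda>x. x) \<in> borel_measurable ?M"
    by (rule continuous_measurable_interval) (rule continuous_on_id)
  then have [measurable]: "(fst :: real \<times> real \<Rightarrow> real) \<in> borel_measurable (?M \<Otimes>\<^sub>M ?M)"
      "(snd :: real \<times> real \<Rightarrow> real) \<in> borel_measurable (?M \<Otimes>\<^sub>M ?M)"
    by (auto intro: measurable_compose[OF measurable_fst, of "\<lambda>x. x"]
        measurable_compose[OF measurable_snd, of "\<lambda>x. x"])
  have [measurable]: "(\<lambda>p. deriv \<phi> (fst p)) \<in> borel_measurable (?M \<Otimes>\<^sub>M ?M)"
      "(\<lambda>p. w (snd p)) \<in> borel_measurable (?M \<Otimes>\<^sub>M ?M)"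
    by (auto intro: measurable_compose[OF measurable_fst] measurable_compose[OF measurable_snd])
  have f_meas [measurable]: "(\<lambda>(x, t). f x t) \<in> borel_measurable (?M \<Otimes>\<^sub>M ?M)"
    unfolding f_def case_prod_beta by measurable
  have f_bound: "norm (f x t) \<le> K * norm (w t)" if "x \<in> {a<..<b}" for x t
    using K(1) K(2)[of x] that by (auto simp: f_def intro: mult_right_mono)
  have f_int: "integrable ?M (f x)" if "x \<in> {a<..<b}" for x
  proof (rule Bochner_Integration.integrable_bound)
    show "integrable ?M (\<lambda>t. K * norm (w t))" using w by simp
    show "f x \<in> borel_measurable ?M"
      using measurable_Pair2[OF f_meas, of x] that by simp
    show "AE t in ?M. norm (f x t) \<le> norm (K * norm (w t))"
      using f_bound[OF that] K(1) by simp
  qed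
  have "integrable (?M \<Otimes>\<^sub>M ?M) (\<lambda>(x, t). f x t)"
  proof (rule Fubini_integrable[OF f_meas])
    have "(\<lambda>x. LINT t|?M. norm (f x t)) \<in> borel_measurable ?M"
      by measurable
    then show "integrable ?M (\<lambda>x. LINT t|?M. norm (case (x, t) of (x, t) \<Rightarrow> f x t))"
    proof (intro integrable_interval_bounded[where K="K * (LINT t|?M. norm (w t))"])
      fix x assume x: "x \<in> {a<..<b}"
      have "(LINT t|?M. norm (f x t)) \<le> (LINT t|?M. K * norm (w t))"
        by (rule integral_mono) (use f_int[OF x] w f_bound[OF x] in auto)
      then show "norm (LINT t|?M. norm (case (x, t) of (x, t) \<Rightarrow> f x t)) \<le> K * (LINT t|?M. norm (w t))"
        by simp
    qed simp
    show "AE x in ?M. integrable ?M (\<lambda>t. case (x, t) of (x, t) \<Rightarrow> f x t)"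
      using f_int by (intro AE_I2) simp
  qed
  then have Fubini: "(LINT x|?M. LINT t|?M. f x t) = (LINT t|?M. LINT x|?M. f x t)"
    by (rule Fubini_integral[symmetric])
  have inner_t: "(LINT t|?M. f x t) = deriv \<phi> x *\<^sub>R integral {a..x} w" if "x \<in> {a<..<b}" for x
  proof -
    have "(LINT t|?M. f x t) = (LINT t|?M. deriv \<phi> x *\<^sub>R (indicat_real {..<x} t *\<^sub>R w t))"
      by (intro Bochner_Integration.integral_cong) (auto simp: f_def)
    also have "\<dots> = deriv \<phi> x *\<^sub>R (LINT t|?M. indicat_real {..<x} t *\<^sub>R w t)"
      by (rule integral_scaleR_right)
    finally show ?thesis
      using integral_below_eq_primitive[OF w, of x] that by simp
  qed
  have inner_x: "(LINT x|?M. f x t) = - (\<phi> t *\<^sub>R w t)" if "t \<in> {a<..<b}" for t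
  proof -
    have "(LINT x|?M. f x t) = (LINT x|?M. (indicat_real {t<..} x * deriv \<phi> x) *\<^sub>R w t)"
      by (intro Bochner_Integration.integral_cong) (auto simp: f_def)
    also have "\<dots> = (LINT x|?M. indicat_real {t<..} x * deriv \<phi> x) *\<^sub>R w t"
    proof (rule integral_scaleR_left)
      show "integrable ?M (\<lambda>x. indicat_real {t<..} x * deriv \<phi> x)"
        by (rule integrable_interval_bounded[where K=K]) (use K in \<open>auto simp: indicator_def\<close>)
    qed
    finally show ?thesis
      using integral_deriv_above[OF \<open>a < b\<close> test, of t] that by simp
  qed
  have int1: "integrable ?M (\<lambda>x. deriv \<phi> x *\<^sub>R c)"
    by (intro integrable_scaleR_continuous integrable_const_interval D)
  have D_int: "integrable ?M (deriv \<phi>)"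
    by (rule integrable_interval_continuous[OF D])
  have "(LINT x|?M. deriv \<phi> x) = (LINT x|?M. indicat_real {a<..} x * deriv \<phi> x)"
    by (intro Bochner_Integration.integral_cong) auto
  then have int0: "(LINT x|?M. deriv \<phi> x *\<^sub>R c) = 0"
    using integral_deriv_above[OF \<open>a < b\<close> test, of a] \<open>\<phi> a = 0\<close> \<open>a < b\<close> D_int by auto
  have "continuous_on {a..b} (\<lambda>x. deriv \<phi> x *\<^sub>R integral {a..x} w)"
    by (intro continuous_on_scaleR D primitive_continuous w)
  then have int2: "integrable ?M (\<lambda>x. deriv \<phi> x *\<^sub>R integral {a..x} w)"
    by (intro L2_integrable L2_continuous)
  have "(LINT x|?M. deriv \<phi> x *\<^sub>R (c + integral {a..x} w)) =
      (LINT x|?M. deriv \<phi> x *\<^sub>R integral {a..x} w)"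
    using int1 int2 int0 by (simp add: scaleR_add_right)
  also have "\<dots> = (LINT x|?M. LINT t|?M. f x t)"
    by (intro Bochner_Integration.integral_cong) (auto simp: inner_t)
  also have "\<dots> = (LINT t|?M. - (\<phi> t *\<^sub>R w t))"
    unfolding Fubini by (intro Bochner_Integration.integral_cong) (auto simp: inner_x)
  finally show "(LINT x|?M. deriv \<phi> x *\<^sub>R (c + integral {a..x} w)) = - (LINT x|?M. \<phi> x *\<^sub>R w x)"
    by simp
qed

section \<open>Functions with weak derivative zero\<close>

lemma test_function_diff_scaled:
  assumes "a < b" "test_function a b f" "test_function a b g"
  shows "test_function a b (\<lambda>x. f x - r * g x)"
proof -
  obtain c d c' d' where cd: "a < c" "c \<le> d" "d < b" "\<And>x. x \<notin> {c..d} \<Longrightarrow> f x = 0"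
    "a < c'" "c' \<le> d'" "d' < b" "\<And>x. x \<notin> {c'..d'} \<Longrightarrow> g x = 0"
    using assms unfolding test_function_iff[OF \<open>a < b\<close>] by blast
  have "smooth (\<lambda>x. f x + (- r) * g x)"
    using assms unfolding test_function_iff[OF \<open>a < b\<close>]
    by (intro smooth_add smooth_mult smooth_const) auto
  moreover have "\<exists>c d. a < c \<and> c \<le> d \<and> d < b \<and> (\<forall>x. x \<notin> {c..d} \<longrightarrow> f x - r * g x = 0)"
  proof (rule exI[of _ "min c c'"], rule exI[of _ "max d d'"], intro conjI allI impI)
    fix x assume "x \<notin> {min c c'..max d d'}"
    then have "x \<notin> {c..d}" "x \<notin> {c'..d'}" by auto
    then show "f x - r * g x = 0" using cd by simp
  qed (use cd in auto)
  ultimately show ?thesis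
    unfolding test_function_iff[OF \<open>a < b\<close>] by simp
qed

text \<open>The primitive that vanishes to the left of the support of \<open>\<eta>\<close> is constant to the right of it, with the
total integral of \<open>\<eta>\<close> as its value there. Mean zero is thus what makes the support of the primitive compact.\<close>

lemma test_function_primitive:
  assumes "a < b" and \<eta>: "test_function a b \<eta>" and "(LINT x|lebesgue_on {a<..<b}. \<eta> x) = 0"
  shows "\<exists>\<phi>. test_function a b \<phi> \<and> deriv \<phi> = \<eta>"
proof -
  obtain c d where cd: "a < c" "c \<le> d" "d < b" "\<And>x. x \<notin> {c..d} \<Longrightarrow> \<eta> x = 0" and "smooth \<eta>"
    using \<eta> unfolding test_function_iff[OF \<open>a < b\<close>] by blast
  have cont: "continuous_on S \<eta>" for S using \<open>smooth \<eta>\<close> by (rule smooth_continuous)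
  define \<phi> where "\<phi> = (\<lambda>x. integral {a..x} \<eta>)"
  have below: "\<phi> x = 0" if "x < c" for x
    unfolding \<phi>_def by (rule integral_unique[OF has_integral_is_0]) (use that cd in auto)
  have above: "\<phi> x = 0" if "x > d" for x
  proof -
    have const: "\<phi> y = \<phi> d" if "y > d" for y
    proof -
      have "integral {a..d} \<eta> + integral {d..y} \<eta> = integral {a..y} \<eta>"
        by (rule Henstock_Kurzweil_Integration.integral_combine)
          (use that cd in \<open>auto intro: integrable_continuous_real cont\<close>)
      moreover have "integral {d<..<y} \<eta> = 0"
        by (rule integral_unique[OF has_integral_is_0]) (use cd in auto)
      ultimately show ?thesis by (simp add: \<phi>_def integral_open_interval_real)
    qed
    have "integrable (lebesgue_on {a<..<b}) \<eta>"
      by (rule integrable_interval_continuous[OF cont])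
    then have "integral {a<..<b} \<eta> = 0"
      using assms(3) by (subst (asm) lebesgue_integral_eq_integral) auto
    then have "\<phi> b = 0" by (simp add: \<phi>_def integral_open_interval_real)
    with const[of b] const[OF that] cd show ?thesis by simp
  qed
  \<comment> \<open>Points up to \<open>a\<close> are treated separately: there the integral over a degenerate interval is zero, which
    agrees with the primitive because the support starts after \<open>a\<close>.\<close>
  have deriv: "(\<phi> has_real_derivative \<eta> x) (at x)" for x
  proof (cases "x > a")
    case True
    have "(\<phi> has_real_derivative \<eta> x) (at x within {a..x + 1})"
      unfolding \<phi>_def by (rule integral_has_real_derivative[OF cont]) (use True in auto)
    moreover have "at x within {a..x + 1} = at x"
      using True by (intro at_within_interior) auto
    ultimately show ?thesis by simp
  next
    case False
    have "((\<lambda>x. 0) has_real_derivative 0) (at x)" by simp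
    then have "(\<phi> has_real_derivative 0) (at x)"
      by (rule has_field_derivative_transform_within_open[of _ _ _ "{..<c}"])
        (use False cd below in auto)
    with False cd show ?thesis by simp
  qed
  then have "deriv \<phi> = \<eta>" by (auto intro: DERIV_imp_deriv)
  moreover have "smooth \<phi>" using smooth_if_deriv deriv \<open>smooth \<eta>\<close> by blast
  moreover have "\<phi> x = 0" if "x \<notin> {c..d}" for x
    using that below[of x] above[of x] by force
  ultimately show ?thesis
    using cd unfolding test_function_iff[OF \<open>a < b\<close>] by blast
qed

lemma test_function_integrable:
  assumes "a < b" "test_function a b \<phi>"
  shows "integrable (lebesgue_on {a<..<b}) \<phi>"
  by (intro integrable_interval_continuous smooth_continuous)
    (use assms test_function_iff[OF \<open>a < b\<close>] in blast)

lemma exists_normalized_test_function: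
  assumes "a < b"
  obtains \<psi> where "test_function a b \<psi>" "(LINT x|lebesgue_on {a<..<b}. \<psi> x) = 1"
proof -
  let ?M = "lebesgue_on {a<..<b}"
  have test: "test_function a b (\<lambda>x. r * plateau a b n x)" for r n
    by (rule test_function_times_plateau[OF \<open>a < b\<close> smooth_const])
  have "(\<lambda>n. LINT x|?M. plateau a b n x) \<longlonglongrightarrow> (LINT x|?M. 1)"
  proof (rule integral_dominated_convergence[where w="\<lambda>_. 1"])
    show "plateau a b n \<in> borel_measurable ?M" for n
      using test_function_integrable[OF \<open>a < b\<close> test[of 1]] by auto
    show "AE x in ?M. (\<lambda>n. plateau a b n x) \<longlonglongrightarrow> 1"
      by (intro AE_I2 plateau_tendsto) auto
    show "AE x in ?M. norm (plateau a b n x) \<le> 1" for n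
      using plateau_bounds by auto
  qed auto
  moreover have "(LINT x|?M. 1) = b - a"
    using integral_const_interval[OF \<open>a < b\<close>, of "1::real"] by simp
  ultimately have lim: "(\<lambda>n. LINT x|?M. plateau a b n x) \<longlonglongrightarrow> b - a"
    by simp
  have "\<exists>n. (LINT x|?M. plateau a b n x) \<noteq> 0"
  proof (rule ccontr)
    assume "\<nexists>n. (LINT x|?M. plateau a b n x) \<noteq> 0"
    then show False using lim \<open>a < b\<close> by (simp add: LIMSEQ_const_iff)
  qed
  then obtain n where n: "(LINT x|?M. plateau a b n x) \<noteq> 0" by blast
  show ?thesis
    by (rule that[OF test[of "1 / (LINT x|?M. plateau a b n x)" n]]) (use n in simp)
qed

text \<open>A function orthogonal to all derivatives of test functions is orthogonal to all test functions of mean zero.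
Since a suitable multiple of one fixed test function corrects the mean of any other, \<open>u\<close> acts on all test
functions like a constant, and the fundamental lemma identifies it with this constant.\<close>

lemma du_Bois_Reymond:
  fixes u :: "real \<Rightarrow> complex"
  assumes "a < b" and u: "integrable (lebesgue_on {a<..<b}) u"
    and weak: "\<And>\<phi>. test_function a b \<phi> \<Longrightarrow> (LINT x|lebesgue_on {a<..<b}. deriv \<phi> x *\<^sub>R u x) = 0"
  shows "\<exists>c. AE x in lebesgue_on {a<..<b}. u x = c"
proof -
  let ?M = "lebesgue_on {a<..<b}"
  have int: "integrable ?M (\<lambda>x. \<psi> x *\<^sub>R v x)" if "test_function a b \<psi>" "integrable ?M v"
    for \<psi> and v :: "real \<Rightarrow> complex"
    using that test_function_iff[OF \<open>a < b\<close>]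
    by (intro integrable_scaleR_continuous smooth_continuous) auto
  obtain \<psi>\<^sub>0 where \<psi>\<^sub>0: "test_function a b \<psi>\<^sub>0" "(LINT x|?M. \<psi>\<^sub>0 x) = 1"
    using exists_normalized_test_function[OF \<open>a < b\<close>] .
  \<comment> \<open>The only possible value, because testing \<open>u - c\<close> with \<open>\<psi>\<^sub>0\<close> must give zero.\<close>
  define c where "c = (LINT x|?M. \<psi>\<^sub>0 x *\<^sub>R u x)"
  have "AE x in ?M. u x - c = 0"
  proof (rule fundamental_lemma_of_variations[OF \<open>a < b\<close>])
    show "integrable ?M (\<lambda>x. u x - c)" using u by simp
    fix \<psi> assume \<psi>: "test_function a b \<psi>"
    define J where "J = (LINT x|?M. \<psi> x)"
    have "test_function a b (\<lambda>x. \<psi> x - J * \<psi>\<^sub>0 x)"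
      by (rule test_function_diff_scaled[OF \<open>a < b\<close> \<psi> \<psi>\<^sub>0(1)])
    moreover have "(LINT x|?M. \<psi> x - J * \<psi>\<^sub>0 x) = 0"
      using test_function_integrable[OF \<open>a < b\<close>] \<psi> \<psi>\<^sub>0 by (simp add: J_def)
    ultimately obtain \<phi> where "test_function a b \<phi>" "deriv \<phi> = (\<lambda>x. \<psi> x - J * \<psi>\<^sub>0 x)"
      using test_function_primitive[OF \<open>a < b\<close>] by blast
    with weak have "0 = (LINT x|?M. (\<psi> x - J * \<psi>\<^sub>0 x) *\<^sub>R u x)" by metis
    also have "\<dots> = (LINT x|?M. \<psi> x *\<^sub>R u x - J *\<^sub>R (\<psi>\<^sub>0 x *\<^sub>R u x))"
      by (simp add: scaleR_diff_left)
    also have "\<dots> = (LINT x|?M. \<psi> x *\<^sub>R u x) - J *\<^sub>R c"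
      using int[OF \<psi> u] int[OF \<psi>\<^sub>0(1) u] by (simp add: c_def del: scaleR_scaleR)
    finally have "(LINT x|?M. \<psi> x *\<^sub>R u x) = J *\<^sub>R c" by simp
    moreover have "(LINT x|?M. \<psi> x *\<^sub>R c) = J *\<^sub>R c"
      using test_function_integrable[OF \<open>a < b\<close> \<psi>] by (cases "c = 0") (simp_all add: J_def)
    ultimately show "(LINT x|?M. \<psi> x *\<^sub>R (u x - c)) = 0"
      using int[OF \<psi> u] int[OF \<psi> integrable_const_interval, of c] by (simp add: scaleR_diff_right)
  qed
  then show ?thesis by auto
qed

text \<open>Subtracting the primitive of \<open>v\<close> from \<open>u\<close> leaves a function with weak derivative zero.\<close>

lemma weak_deriv_representation:
  assumes "a < b" "u \<in> L2 a b" "v \<in> L2 a b" and weak: "has_weak_deriv a b u v"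
  shows "\<exists>c. AE x in lebesgue_on {a<..<b}. u x = c + integral {a..x} v"
proof -
  let ?M = "lebesgue_on {a<..<b}"
  note u = L2_integrable[OF assms(2)] and v = L2_integrable[OF assms(3)]
  have V: "integrable ?M (\<lambda>x. integral {a..x} v)"
    by (intro L2_integrable L2_continuous primitive_continuous v)
  have "\<exists>c. AE x in ?M. u x - integral {a..x} v = c"
  proof (rule du_Bois_Reymond[OF \<open>a < b\<close>])
    show "integrable ?M (\<lambda>x. u x - integral {a..x} v)"
      using u V by simp
    fix \<phi> assume \<phi>: "test_function a b \<phi>"
    then have D: "continuous_on {a..b} (deriv \<phi>)"
      using test_function_iff[OF \<open>a < b\<close>] smooth_continuous smooth_deriv by blast
    show "(LINT x|?M. deriv \<phi> x *\<^sub>R (u x - integral {a..x} v)) = 0"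
      using weak primitive_has_weak_deriv[OF \<open>a < b\<close> v, of 0] \<phi>
        integrable_scaleR_continuous[OF u D] integrable_scaleR_continuous[OF V D]
      by (simp add: has_weak_deriv_def scaleR_diff_right)
  qed
  then show ?thesis by (auto elim!: eventually_mono simp: algebra_simps)
qed

section \<open>The Sobolev space\<close>

lemma has_weak_deriv_AE_cong:
  assumes "has_weak_deriv a b u v" "u \<in> borel_measurable (lebesgue_on {a<..<b})"
    "u' \<in> borel_measurable (lebesgue_on {a<..<b})" "AE x in lebesgue_on {a<..<b}. u x = u' x"
    and "a < b"
  shows "has_weak_deriv a b u' v"
  unfolding has_weak_deriv_def
proof (intro allI impI)
  fix \<phi> assume \<phi>: "test_function a b \<phi>"
  then have "continuous_on {a..b} (deriv \<phi>)"
    using test_function_iff[OF \<open>a < b\<close>] smooth_continuous smooth_deriv by blast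
  then have [measurable]: "deriv \<phi> \<in> borel_measurable (lebesgue_on {a<..<b})"
    by (rule continuous_measurable_interval)
  note [measurable] = assms(2,3)
  have "(LINT x|lebesgue_on {a<..<b}. deriv \<phi> x *\<^sub>R u' x) = (LINT x|lebesgue_on {a<..<b}. deriv \<phi> x *\<^sub>R u x)"
    by (rule integral_cong_AE) (use assms(4) in \<open>auto elim: eventually_mono\<close>)
  then show "(LINT x|lebesgue_on {a<..<b}. deriv \<phi> x *\<^sub>R u' x) = - (LINT x|lebesgue_on {a<..<b}. \<phi> x *\<^sub>R v x)"
    using assms(1) \<phi> by (simp add: has_weak_deriv_def)
qed

lemma has_weak_deriv_add:
  assumes "a < b" "u \<in> L2 a b" "u' \<in> L2 a b" "v \<in> L2 a b" "v' \<in> L2 a b"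
    "has_weak_deriv a b u v" "has_weak_deriv a b u' v'"
  shows "has_weak_deriv a b (\<lambda>x. u x + u' x) (\<lambda>x. v x + v' x)"
  unfolding has_weak_deriv_def
proof (intro allI impI)
  fix \<phi> assume \<phi>: "test_function a b \<phi>"
  then have "continuous_on {a..b} \<phi>" "continuous_on {a..b} (deriv \<phi>)"
    using test_function_iff[OF \<open>a < b\<close>] smooth_continuous smooth_deriv by blast+
  note int = integrable_scaleR_continuous[OF L2_integrable this(1)] integrable_scaleR_continuous[OF L2_integrable this(2)]
  show "(LINT x|lebesgue_on {a<..<b}. deriv \<phi> x *\<^sub>R (u x + u' x)) = - (LINT x|lebesgue_on {a<..<b}. \<phi> x *\<^sub>R (v x + v' x))"
    using assms \<phi> by (simp add: scaleR_add_right int has_weak_deriv_def)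
qed

lemma has_weak_deriv_cmult:
  assumes "has_weak_deriv a b u v"
  shows "has_weak_deriv a b (\<lambda>x. c * u x) (\<lambda>x. c * v x)"
proof -
  have "r *\<^sub>R (c * z) = c * (r *\<^sub>R z)" for r z by simp
  then show ?thesis
    using assms unfolding has_weak_deriv_def
    by (simp only: integral_mult_right_zero) simp
qed

lemma has_weak_deriv_diff:
  assumes "a < b" "u \<in> L2 a b" "u' \<in> L2 a b" "v \<in> L2 a b" "v' \<in> L2 a b"
    "has_weak_deriv a b u v" "has_weak_deriv a b u' v'"
  shows "has_weak_deriv a b (\<lambda>x. u x - u' x) (\<lambda>x. v x - v' x)"
  using has_weak_deriv_add[OF assms(1,2) L2_cmult[OF assms(3), of "-1"] assms(4) L2_cmult[OF assms(5), of "-1"]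
      assms(6) has_weak_deriv_cmult[OF assms(7)]]
  by simp

lemma weak_deriv_unique:
  assumes "a < b" "v \<in> L2 a b" "v' \<in> L2 a b" "has_weak_deriv a b u v" "has_weak_deriv a b u v'"
  shows "AE x in lebesgue_on {a<..<b}. v x = v' x"
proof -
  note v = L2_integrable[OF assms(2)] L2_integrable[OF assms(3)]
  have "AE x in lebesgue_on {a<..<b}. v x - v' x = 0"
  proof (rule fundamental_lemma_of_variations[OF \<open>a < b\<close>])
    fix \<phi> assume \<phi>: "test_function a b \<phi>"
    then have "continuous_on {a..b} \<phi>"
      using test_function_iff[OF \<open>a < b\<close>] smooth_continuous by blast
    then show "(LINT x|lebesgue_on {a<..<b}. \<phi> x *\<^sub>R (v x - v' x)) = 0"
      using assms(4,5) \<phi> integrable_scaleR_continuous[OF v(1)] integrable_scaleR_continuous[OF v(2)]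
      by (simp add: has_weak_deriv_def scaleR_diff_right)
  qed (use v in simp)
  then show ?thesis by simp
qed

lemma weak_deriv:
  assumes "u \<in> H1 a b"
  shows "weak_deriv a b u \<in> L2 a b" "has_weak_deriv a b u (weak_deriv a b u)"
proof -
  have "\<exists>v. v \<in> L2 a b \<and> has_weak_deriv a b u v"
    using assms by (auto simp: H1_def)
  from someI_ex[OF this]
  show "weak_deriv a b u \<in> L2 a b" "has_weak_deriv a b u (weak_deriv a b u)"
    by (simp_all add: weak_deriv_def)
qed

lemma H1_L2: "u \<in> H1 a b \<Longrightarrow> u \<in> L2 a b"
  by (simp add: H1_def)

lemma H1_add:
  assumes "a < b" "u \<in> H1 a b" "v \<in> H1 a b"
  shows "(\<lambda>x. u x + v x) \<in> H1 a b"
  using has_weak_deriv_add[OF \<open>a < b\<close> H1_L2[OF assms(2)] H1_L2[OF assms(3)]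
      weak_deriv(1)[OF assms(2)] weak_deriv(1)[OF assms(3)] weak_deriv(2)[OF assms(2)] weak_deriv(2)[OF assms(3)]]
    L2_add[OF weak_deriv(1)[OF assms(2)] weak_deriv(1)[OF assms(3)]]
    L2_add[OF H1_L2[OF assms(2)] H1_L2[OF assms(3)]]
  by (auto simp: H1_def)

lemma H1_cmult:
  assumes "u \<in> H1 a b"
  shows "(\<lambda>x. c * u x) \<in> H1 a b"
  using has_weak_deriv_cmult[OF weak_deriv(2)[OF assms], of c]
    L2_cmult[OF weak_deriv(1)[OF assms], of c] L2_cmult[OF H1_L2[OF assms], of c]
  by (auto simp: H1_def)

lemma H1_diff: "a < b \<Longrightarrow> u \<in> H1 a b \<Longrightarrow> v \<in> H1 a b \<Longrightarrow> (\<lambda>x. u x - v x) \<in> H1 a b"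
  using H1_add[OF _ _ H1_cmult, of a b u v "-1"] by simp

lemma primitive_in_H1:
  assumes "a < b" "v \<in> L2 a b"
  shows "(\<lambda>x. c + integral {a..x} v) \<in> H1 a b"
proof -
  have "(\<lambda>x. c + integral {a..x} v) \<in> L2 a b"
    by (intro L2_continuous continuous_on_add continuous_on_const primitive_continuous
        L2_integrable assms(2))
  then show ?thesis
    using primitive_has_weak_deriv[OF \<open>a < b\<close> L2_integrable[OF assms(2)]] assms(2)
    by (auto simp: H1_def)
qed

lemma C1_eq_primitive:
  assumes "u \<in> C1 a b"
  obtains u' where "continuous_on {a..b} u'" "\<And>x. x \<in> {a..b} \<Longrightarrow> u x = u a + integral {a..x} u'"
proof -
  obtain u' where u': "continuous_on {a..b} u'"
      "\<And>x. x \<in> {a..b} \<Longrightarrow> (u has_vector_derivative u' x) (at x within {a..b})"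
    using assms by (auto simp: C1_def)
  have "u x = u a + integral {a..x} u'" if "x \<in> {a..b}" for x
  proof -
    have "(u' has_integral (u x - u a)) {a..x}"
      by (rule fundamental_theorem_of_calculus)
        (use that in \<open>auto intro: has_vector_derivative_within_subset[OF u'(2)]\<close>)
    then show ?thesis by (auto dest: integral_unique)
  qed
  with u'(1) show ?thesis by (rule that)
qed

lemma primitive_in_C1:
  assumes "continuous_on {a..b} g"
  shows "(\<lambda>x. c + integral {a..x} g) \<in> C1 a b"
proof -
  have "((\<lambda>x. c + integral {a..x} g) has_vector_derivative 0 + g x) (at x within {a..b})"
    if "x \<in> {a..b}" for x
    by (intro has_vector_derivative_add has_vector_derivative_const
        integral_has_vector_derivative[OF assms that])
  with assms show ?thesis by (auto simp: C1_def)
qed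

lemma C1_continuous: "u \<in> C1 a b \<Longrightarrow> continuous_on {a..b} u"
  unfolding C1_def continuous_on_eq_continuous_within
  by (blast intro: has_vector_derivative_continuous)

text \<open>By the fundamental theorem of calculus the classical derivative is a special case of
\<open>primitive_has_weak_deriv\<close>, including the one-sided derivatives at the end points.\<close>

lemma C1_subset_H1:
  assumes "a < b"
  shows "C1 a b \<subseteq> H1 a b"
proof
  fix u assume u: "u \<in> C1 a b"
  then have u_L2: "u \<in> L2 a b" by (intro L2_continuous C1_continuous)
  obtain u' where u': "continuous_on {a..b} u'" "\<And>x. x \<in> {a..b} \<Longrightarrow> u x = u a + integral {a..x} u'"
    using C1_eq_primitive[OF u] by blast
  let ?p = "\<lambda>x. u a + integral {a..x} u'"
  have p: "?p \<in> H1 a b" "has_weak_deriv a b ?p u'"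
    using primitive_in_H1[OF \<open>a < b\<close> L2_continuous[OF u'(1)]]
      primitive_has_weak_deriv[OF \<open>a < b\<close> L2_integrable[OF L2_continuous[OF u'(1)]]] by auto
  have "has_weak_deriv a b u u'"
  proof (rule has_weak_deriv_AE_cong[OF p(2)])
    show "AE x in lebesgue_on {a<..<b}. ?p x = u x"
    proof (rule AE_I2)
      fix x assume "x \<in> space (lebesgue_on {a<..<b})"
      then show "?p x = u x" by (intro u'(2)[symmetric]) simp
    qed
  qed (use H1_L2[OF p(1)] u_L2 \<open>a < b\<close> in \<open>auto simp: L2_def\<close>)
  with u_L2 L2_continuous[OF u'(1)] show "u \<in> H1 a b" by (auto simp: H1_def)
qed

section \<open>Continuous representatives\<close>

definition continuous_rep :: "real \<Rightarrow> real \<Rightarrow> (real \<Rightarrow> complex) \<Rightarrow> (real \<Rightarrow> complex) \<Rightarrow> bool" where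
  "continuous_rep a b u g \<longleftrightarrow> continuous_on {a..b} g \<and> (AE x in lebesgue_on {a<..<b}. u x = g x)"

text \<open>The functions agree on a closed set of full measure, which therefore contains the open interval; continuity
carries the equality to the end points, where the trace is read off.\<close>

lemma continuous_rep_unique:
  assumes "a < b" "continuous_rep a b u g" "continuous_rep a b u h" "x \<in> {a..b}"
  shows "g x = h x"
proof -
  define C where "C = {x \<in> {a..b}. g x - h x = 0}"
  have "closed C"
    unfolding C_def
    by (rule continuous_closed_preimage_constant)
      (use assms in \<open>auto simp: continuous_rep_def intro: continuous_on_diff\<close>)
  have "AE x in lebesgue_on {a<..<b}. u x = g x" "AE x in lebesgue_on {a<..<b}. u x = h x"
    using assms by (auto simp: continuous_rep_def)
  then have "AE x in lebesgue_on {a<..<b}. g x - h x = 0"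
    by eventually_elim simp
  then have "AE x \<in> {a<..<b} in lebesgue. g x - h x = 0"
    by (subst (asm) AE_restrict_space_iff) auto
  then have "AE x \<in> {a<..<b} in lebesgue. x \<in> C"
    by eventually_elim (simp add: C_def)
  then have "{a<..<b} \<subseteq> C"
    using mem_closed_if_AE_lebesgue_open[OF open_greaterThanLessThan \<open>closed C\<close>] by (intro subsetI)
  then have "closure {a<..<b} \<subseteq> C"
    using \<open>closed C\<close> by (rule closure_minimal)
  with assms show ?thesis by (auto simp: C_def)
qed

lemma H1_continuous_rep:
  assumes "a < b" "u \<in> H1 a b"
  obtains c where "continuous_rep a b u (\<lambda>x. c + integral {a..x} (weak_deriv a b u))"
proof -
  obtain c where "AE x in lebesgue_on {a<..<b}. u x = c + integral {a..x} (weak_deriv a b u)"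
    using weak_deriv_representation[OF \<open>a < b\<close> H1_L2[OF assms(2)] weak_deriv[OF assms(2)]] by blast
  moreover have "continuous_on {a..b} (\<lambda>x. c + integral {a..x} (weak_deriv a b u))"
    by (intro continuous_on_add continuous_on_const primitive_continuous L2_integrable weak_deriv assms(2))
  ultimately show ?thesis using that by (auto simp: continuous_rep_def)
qed

text \<open>A difference of two values is an integral of the weak derivative over an interval between the two points.\<close>

lemma continuous_rep_oscillation:
  assumes "a < b" "u \<in> H1 a b" "continuous_rep a b u g" "x \<in> {a..b}" "y \<in> {a..b}"
  shows "norm (g x - g y) \<le> sqrt (b - a) * L2_norm a b (weak_deriv a b u)"
proof -
  obtain c where c: "continuous_rep a b u (\<lambda>x. c + integral {a..x} (weak_deriv a b u))"
    using H1_continuous_rep[OF assms(1,2)] .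
  note v = weak_deriv(1)[OF assms(2)]
  have "norm (g x - g y) = norm (integral {a..x} (weak_deriv a b u) - integral {a..y} (weak_deriv a b u))"
    using continuous_rep_unique[OF \<open>a < b\<close> assms(3) c] assms(4,5) by simp
  also have "\<dots> \<le> (LINT t|lebesgue_on {a<..<b}. norm (weak_deriv a b u t))"
    by (rule primitive_diff_le[OF L2_integrable[OF v] assms(4,5)])
  also have "\<dots> \<le> sqrt (b - a) * L2_norm a b (weak_deriv a b u)"
    by (rule L1_norm_le_L2_norm[OF \<open>a < b\<close> v])
  finally show ?thesis .
qed

lemma L2_norm_nonneg [simp]: "L2_norm a b u \<ge> 0"
  by (simp add: L2_norm_def)

text \<open>The Poincare inequality for the continuous representative, anchored at an arbitrary point. At an end point
it is the result sought; it also controls the lower-order term in the density of \<open>C1\<close> in \<open>H1\<close>.\<close>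

lemma Poincare_continuous_rep:
  assumes "a < b" "u \<in> H1 a b" "continuous_rep a b u g" "x\<^sub>0 \<in> {a..b}"
  shows "L2_norm a b u \<le> sqrt (b - a) * (norm (g x\<^sub>0) + sqrt (b - a) * L2_norm a b (weak_deriv a b u))"
proof (rule L2_norm_bounded[OF \<open>a < b\<close> H1_L2[OF assms(2)]])
  have g: "norm (g x) \<le> norm (g x\<^sub>0) + sqrt (b - a) * L2_norm a b (weak_deriv a b u)" if "x \<in> {a..b}" for x
    using continuous_rep_oscillation[OF assms(1-3) that assms(4)] norm_triangle_ineq2[of "g x" "g x\<^sub>0"] by linarith
  have "AE x in lebesgue_on {a<..<b}. x \<in> {a<..<b}" by (intro AE_I2) simp
  moreover have "AE x in lebesgue_on {a<..<b}. u x = g x"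
    using assms(3) by (simp add: continuous_rep_def)
  ultimately show "AE x in lebesgue_on {a<..<b}. norm (u x) \<le> norm (g x\<^sub>0) + sqrt (b - a) * L2_norm a b (weak_deriv a b u)"
  proof eventually_elim
    case (elim x)
    then show ?case using g[of x] by auto
  qed
qed (use \<open>a < b\<close> in simp)

lemma L2_norm_le_H1_norm: "L2_norm a b u \<le> H1_norm a b u" "L2_norm a b (weak_deriv a b u) \<le> H1_norm a b u"
  by (auto simp: L2_norm_def H1_norm_def)

lemma H1_norm_le: "H1_norm a b u \<le> L2_norm a b u + L2_norm a b (weak_deriv a b u)"
  unfolding L2_norm_def H1_norm_def by (rule sqrt_add_le_add_sqrt) auto

text \<open>The Sobolev embedding: bound the value at \<open>x\<close> by the value at \<open>y\<close> plus the oscillation and average over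
all \<open>y\<close> in the interval. At the end points this is the boundedness of the trace.\<close>

lemma continuous_rep_bound:
  assumes "a < b" "u \<in> H1 a b" "continuous_rep a b u g" "x \<in> {a..b}"
  shows "norm (g x) \<le> (1 / sqrt (b - a) + sqrt (b - a)) * H1_norm a b u"
proof -
  let ?M = "lebesgue_on {a<..<b}"
  define r where "r = sqrt (b - a)"
  have r: "r > 0" "b - a = r * r" using \<open>a < b\<close> by (auto simp: r_def)
  define D where "D = L2_norm a b (weak_deriv a b u)"
  have u: "integrable ?M u" by (intro L2_integrable H1_L2 assms)
  have "(b - a) * norm (g x) = (LINT y|?M. norm (g x))"
    using \<open>a < b\<close> by (simp add: measure_interval)
  also have "\<dots> \<le> (LINT y|?M. norm (u y) + r * D)"
  proof (rule integral_mono_AE)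
    have le: "norm (g x) \<le> norm (g y) + r * D" if "y \<in> {a..b}" for y
      using continuous_rep_oscillation[OF assms that] norm_triangle_ineq2[of "g x" "g y"]
      unfolding r_def D_def by linarith
    have "AE y in ?M. y \<in> {a<..<b}" by (intro AE_I2) simp
    moreover have "AE y in ?M. u y = g y"
      using assms(3) by (simp add: continuous_rep_def)
    ultimately show "AE y in ?M. norm (g x) \<le> norm (u y) + r * D"
    proof eventually_elim
      case (elim y)
      then show ?case using le[of y] by auto
    qed
  qed (use u in auto)
  also have "\<dots> = (LINT y|?M. norm (u y)) + (b - a) * (r * D)"
    using u \<open>a < b\<close> by (simp add: measure_interval)
  also have "(LINT y|?M. norm (u y)) \<le> r * L2_norm a b u"
    unfolding r_def by (rule L1_norm_le_L2_norm[OF \<open>a < b\<close> H1_L2[OF assms(2)]])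
  finally have "r * (r * norm (g x)) \<le> r * (L2_norm a b u + r * r * D)"
    unfolding r(2) by (simp add: algebra_simps)
  then have "r * norm (g x) \<le> L2_norm a b u + r * r * D"
    using r(1) by simp
  then have "norm (g x) \<le> (1 / r) * L2_norm a b u + r * D"
    using r(1) by (simp add: field_simps)
  also have "\<dots> \<le> (1 / r) * H1_norm a b u + r * H1_norm a b u"
    unfolding D_def using r(1) L2_norm_le_H1_norm by (intro add_mono mult_left_mono) auto
  finally show ?thesis by (simp add: r_def ring_distribs)
qed

section \<open>Density of continuously differentiable functions\<close>

text \<open>Truncation of the values reduces to bounded functions, which are limits of uniformly bounded continuous
functions.\<close>

lemma L2_continuous_dense:
  assumes v: "v \<in> L2 a b" and "e > 0"
  obtains g where "continuous_on UNIV g" "L2_norm a b (\<lambda>x. v x - g x) < e"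
proof -
  let ?M = "lebesgue_on {a<..<b}"
  have [measurable]: "v \<in> borel_measurable ?M" and v2: "integrable ?M (\<lambda>x. (norm (v x))\<^sup>2)"
    using v by (auto simp: L2_def)
  define t where "t = (\<lambda>(n::nat) x. if norm (v x) \<le> real n then v x else 0)"
  have [measurable]: "t n \<in> borel_measurable ?M" for n unfolding t_def by measurable
  have "(\<lambda>n. LINT x|?M. (norm (v x - t n x))\<^sup>2) \<longlonglongrightarrow> (LINT x|?M. 0)"
  proof (rule integral_dominated_convergence[OF _ _ v2])
    show "AE x in ?M. (\<lambda>n. (norm (v x - t n x))\<^sup>2) \<longlonglongrightarrow> 0"
    proof (rule AE_I2)
      fix x
      obtain N where "norm (v x) \<le> real N" using real_arch_simple by blast
      then have "\<forall>\<^sub>F n in sequentially. (norm (v x - t n x))\<^sup>2 = 0"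
        unfolding eventually_sequentially
        by (intro exI[of _ N] allI impI) (auto simp: t_def)
      then show "(\<lambda>n. (norm (v x - t n x))\<^sup>2) \<longlonglongrightarrow> 0"
        by (rule tendsto_eventually)
    qed
    show "AE x in ?M. norm ((norm (v x - t n x))\<^sup>2) \<le> (norm (v x))\<^sup>2" for n
      by (auto simp: t_def)
  qed measurable
  then have lim_t: "(\<lambda>n. LINT x|?M. (norm (v x - t n x))\<^sup>2) \<longlonglongrightarrow> 0" by simp
  have e: "e\<^sup>2 / 4 > 0" using \<open>e > 0\<close> by simp
  obtain n where n: "(LINT x|?M. (norm (v x - t n x))\<^sup>2) < e\<^sup>2 / 4"
    using eventually_happens'[OF sequentially_bot order_tendstoD(2)[OF lim_t e]] by blast
  have t_bound: "norm (t n x) \<le> real n" for x by (simp add: t_def)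
  obtain g where g: "\<And>k::nat. continuous_on UNIV (g k)" "\<And>k x. norm (g k x) \<le> real n"
    "AE x in ?M. (\<lambda>k. g k x) \<longlonglongrightarrow> t n x"
    by (rule continuous_approx_of_bounded_measurable[of "t n" "{a<..<b}" "real n"]) (use t_bound in auto)
  have g_L2: "g k \<in> L2 a b" for k
    using g(1) by (intro L2_continuous) (rule continuous_on_subset, auto)
  have [measurable]: "g k \<in> borel_measurable ?M" for k
    using g_L2 by (auto simp: L2_def)
  have t_L2: "t n \<in> L2 a b" by (rule L2_bounded[where K="real n"]) (use t_bound in auto)
  have "(\<lambda>k. LINT x|?M. (norm (t n x - g k x))\<^sup>2) \<longlonglongrightarrow> (LINT x|?M. 0)"
  proof (rule integral_dominated_convergence[where w="\<lambda>_. (2 * real n)\<^sup>2"])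
    show "AE x in ?M. (\<lambda>k. (norm (t n x - g k x))\<^sup>2) \<longlonglongrightarrow> 0"
      using g(3) by eventually_elim (auto intro!: tendsto_eq_intros)
    have "norm (t n x - g k x) \<le> 2 * real n" for k x
      using norm_triangle_ineq4[of "t n x" "g k x"] t_bound[of x] g(2)[of k x] by linarith
    then have "(norm (t n x - g k x))\<^sup>2 \<le> (2 * real n)\<^sup>2" for k x
      by (intro power_mono) auto
    then show "AE x in ?M. norm ((norm (t n x - g k x))\<^sup>2) \<le> (2 * real n)\<^sup>2" for k
      by (intro AE_I2) simp
  qed auto
  then have lim_g: "(\<lambda>k. LINT x|?M. (norm (t n x - g k x))\<^sup>2) \<longlonglongrightarrow> 0" by simp
  obtain k where k: "(LINT x|?M. (norm (t n x - g k x))\<^sup>2) < e\<^sup>2 / 4"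
    using eventually_happens'[OF sequentially_bot order_tendstoD(2)[OF lim_g e]] by blast
  have int: "integrable ?M (\<lambda>x. (norm (v x - t n x))\<^sup>2)" "integrable ?M (\<lambda>x. (norm (t n x - g k x))\<^sup>2)"
    "integrable ?M (\<lambda>x. (norm (v x - g k x))\<^sup>2)"
    using L2_diff[OF v t_L2] L2_diff[OF t_L2 g_L2] L2_diff[OF v g_L2] by (auto simp: L2_def)
  \<comment> \<open>Both errors are below a quarter of the squared tolerance, which compensates the factor 2 in the
    inequality for the square of a sum.\<close>
  have "(LINT x|?M. (norm (v x - g k x))\<^sup>2) \<le> (LINT x|?M. 2 * (norm (v x - t n x))\<^sup>2 + 2 * (norm (t n x - g k x))\<^sup>2)"
  proof (rule integral_mono)
    fix x
    have "(norm (v x - g k x))\<^sup>2 \<le> (norm (v x - t n x) + norm (t n x - g k x))\<^sup>2"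
      using norm_triangle_ineq[of "v x - t n x" "t n x - g k x"] by (intro power_mono) auto
    also have "\<dots> \<le> 2 * (norm (v x - t n x))\<^sup>2 + 2 * (norm (t n x - g k x))\<^sup>2"
      using sum_squares_bound[of "norm (v x - t n x)" "norm (t n x - g k x)"] by (simp add: power2_sum)
    finally show "(norm (v x - g k x))\<^sup>2 \<le> 2 * (norm (v x - t n x))\<^sup>2 + 2 * (norm (t n x - g k x))\<^sup>2" .
  qed (use int in auto)
  also have "\<dots> < e\<^sup>2"
    using int n k by simp
  finally have "L2_norm a b (\<lambda>x. v x - g k x) < sqrt (e\<^sup>2)"
    unfolding L2_norm_def by (rule real_sqrt_less_mono)
  with \<open>e > 0\<close> g(1) show ?thesis by (intro that) auto
qed

text \<open>Approximate the weak derivative in \<open>L2\<close> by a continuous function and integrate, starting from the same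
constant. The difference vanishes at \<open>a\<close>, so its \<open>L2\<close> norm is controlled by that of its weak derivative.\<close>

lemma C1_dense_in_H1:
  assumes "a < b" "u \<in> H1 a b" "e > 0"
  obtains w where "w \<in> C1 a b" "H1_norm a b (\<lambda>x. u x - w x) < e"
proof -
  let ?v = "weak_deriv a b u"
  note v = weak_deriv[OF assms(2)]
  obtain c where c: "continuous_rep a b u (\<lambda>x. c + integral {a..x} ?v)"
    using H1_continuous_rep[OF assms(1,2)] .
  \<comment> \<open>The divisor is the constant in the bound of the \<open>H1\<close> norm of the difference by the \<open>L2\<close> norm of its
    weak derivative.\<close>
  have "e / (b - a + 1) > 0" using assms by simp
  then obtain g where g: "continuous_on UNIV g" "L2_norm a b (\<lambda>x. ?v x - g x) < e / (b - a + 1)"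
    using L2_continuous_dense[OF v(1)] by blast
  have gc: "continuous_on {a..b} g" using g(1) continuous_on_subset by blast
  have g_L2: "g \<in> L2 a b" using gc by (rule L2_continuous)
  define w where "w = (\<lambda>x. c + integral {a..x} g)"
  have w: "w \<in> C1 a b" unfolding w_def by (rule primitive_in_C1[OF gc])
  then have w_H1: "w \<in> H1 a b" using C1_subset_H1[OF \<open>a < b\<close>] by blast
  let ?d = "\<lambda>x. u x - w x"
  have d: "?d \<in> H1 a b" by (rule H1_diff[OF assms(1,2) w_H1])
  have "has_weak_deriv a b w g"
    unfolding w_def by (rule primitive_has_weak_deriv[OF \<open>a < b\<close> L2_integrable[OF g_L2]])
  then have "has_weak_deriv a b ?d (\<lambda>x. ?v x - g x)"
    by (intro has_weak_deriv_diff[OF \<open>a < b\<close> H1_L2[OF assms(2)] H1_L2[OF w_H1] v(1) g_L2 v(2)])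
  then have "AE x in lebesgue_on {a<..<b}. weak_deriv a b ?d x = ?v x - g x"
    by (intro weak_deriv_unique[OF \<open>a < b\<close> weak_deriv(1)[OF d] L2_diff[OF v(1) g_L2] weak_deriv(2)[OF d]])
  then have D: "L2_norm a b (weak_deriv a b ?d) = L2_norm a b (\<lambda>x. ?v x - g x)"
    by (intro L2_norm_AE_cong weak_deriv(1)[OF d] L2_diff[OF v(1) g_L2])
  have rep: "continuous_rep a b ?d (\<lambda>x. (c + integral {a..x} ?v) - w x)"
    using c C1_continuous[OF w] unfolding continuous_rep_def by (auto intro: continuous_on_diff elim: eventually_mono)
  have "L2_norm a b ?d \<le> sqrt (b - a) * (sqrt (b - a) * L2_norm a b (weak_deriv a b ?d))"
    using Poincare_continuous_rep[OF \<open>a < b\<close> d rep, of a] \<open>a < b\<close> by (simp add: w_def)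
  also have "\<dots> = (b - a) * L2_norm a b (weak_deriv a b ?d)"
    using \<open>a < b\<close> by (simp flip: mult.assoc)
  finally have "L2_norm a b ?d \<le> (b - a) * L2_norm a b (weak_deriv a b ?d)" .
  then have "H1_norm a b ?d \<le> (b - a + 1) * L2_norm a b (weak_deriv a b ?d)"
    using H1_norm_le[of a b ?d] by (simp add: algebra_simps)
  also have "\<dots> < e"
    using g(2) \<open>a < b\<close> unfolding D by (simp add: field_simps)
  finally show ?thesis using w by (rule that[rotated])
qed

section \<open>The trace operator\<close>

text \<open>Extensional in both arguments, because uniqueness of the trace operator is equality of functions.\<close>

definition boundary_values :: "real \<Rightarrow> real \<Rightarrow> (real \<Rightarrow> complex) \<Rightarrow> real \<Rightarrow> complex" where
  "boundary_values a b = (\<lambda>u\<in>H1 a b. restrict (SOME g. continuous_rep a b u g) {a, b})"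

lemma boundary_values_eq:
  assumes "a < b" "u \<in> H1 a b" "continuous_rep a b u g" "x \<in> {a, b}"
  shows "boundary_values a b u x = g x"
proof -
  have "continuous_rep a b u (SOME g. continuous_rep a b u g)"
    using assms(3) by (rule someI[where P="continuous_rep a b u"])
  then show ?thesis
    using continuous_rep_unique[OF \<open>a < b\<close> _ assms(3), of "SOME g. continuous_rep a b u g" x] assms
    by (auto simp: boundary_values_def)
qed

lemma is_trace_operator_boundary_values:
  assumes "a < b"
  shows "is_trace_operator a b (boundary_values a b)"
  unfolding is_trace_operator_def
proof (intro conjI ballI allI)
  show "boundary_values a b \<in> H1 a b \<rightarrow>\<^sub>E L2_boundary a b"
    by (auto simp: boundary_values_def L2_boundary_def)
next
  fix u v x assume uv: "u \<in> H1 a b" "v \<in> H1 a b" "x \<in> {a, b}"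
  obtain g h where gh: "continuous_rep a b u g" "continuous_rep a b v h"
    using H1_continuous_rep \<open>a < b\<close> uv by metis
  then have "AE y in lebesgue_on {a<..<b}. u y = g y" "AE y in lebesgue_on {a<..<b}. v y = h y"
    by (auto simp: continuous_rep_def)
  then have "AE y in lebesgue_on {a<..<b}. u y + v y = g y + h y"
    by eventually_elim simp
  with gh have "continuous_rep a b (\<lambda>y. u y + v y) (\<lambda>y. g y + h y)"
    unfolding continuous_rep_def by (auto intro: continuous_on_add)
  then show "boundary_values a b (\<lambda>y. u y + v y) x = boundary_values a b u x + boundary_values a b v x"
    using boundary_values_eq[OF \<open>a < b\<close>] uv gh H1_add[OF \<open>a < b\<close>] by simp
next
  fix c u x assume u: "u \<in> H1 a b" "x \<in> {a, b}"
  obtain g where g: "continuous_rep a b u g"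
    using H1_continuous_rep \<open>a < b\<close> u by metis
  then have "continuous_rep a b (\<lambda>y. c * u y) (\<lambda>y. c * g y)"
    unfolding continuous_rep_def by (auto intro: continuous_on_mult_left elim: eventually_mono)
  then show "boundary_values a b (\<lambda>y. c * u y) x = c * boundary_values a b u x"
    using boundary_values_eq[OF \<open>a < b\<close>] u g H1_cmult by simp
next
  define B where "B = 1 / sqrt (b - a) + sqrt (b - a)"
  have "L2_boundary_norm a b (boundary_values a b u) \<le> (2 * B) * H1_norm a b u" if u: "u \<in> H1 a b" for u
  proof -
    obtain g where g: "continuous_rep a b u g"
      using H1_continuous_rep \<open>a < b\<close> u by metis
    have "L2_boundary_norm a b (boundary_values a b u) \<le> norm (g a) + norm (g b)"
      unfolding L2_boundary_norm_def
      using boundary_values_eq[OF \<open>a < b\<close> u g] by (simp add: sqrt_sum_squares_le_sum)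
    also have "\<dots> \<le> B * H1_norm a b u + B * H1_norm a b u"
      unfolding B_def using continuous_rep_bound[OF \<open>a < b\<close> u g] \<open>a < b\<close> by (intro add_mono) auto
    finally show ?thesis by simp
  qed
  then show "\<exists>B. \<forall>u\<in>H1 a b. L2_boundary_norm a b (boundary_values a b u) \<le> B * H1_norm a b u"
    by blast
next
  fix u assume u: "u \<in> C1 a b"
  then have "u \<in> H1 a b" using C1_subset_H1[OF \<open>a < b\<close>] by blast
  moreover have "continuous_rep a b u u"
    using C1_continuous[OF u] by (simp add: continuous_rep_def)
  ultimately have "boundary_values a b u x = u x" if "x \<in> {a, b}" for x
    using boundary_values_eq[OF \<open>a < b\<close>] that by blast
  moreover have "boundary_values a b u x = undefined" if "x \<notin> {a, b}" for x
    using that \<open>u \<in> H1 a b\<close> by (simp add: boundary_values_def)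
  ultimately show "boundary_values a b u = restrict u {a, b}"
    by (auto simp: restrict_def)
qed

lemma norm_le_L2_boundary_norm: "x \<in> {a, b} \<Longrightarrow> norm (\<phi> x) \<le> L2_boundary_norm a b \<phi>"
  by (auto simp: L2_boundary_norm_def intro: real_le_rsqrt)

text \<open>The trace of \<open>u\<close> is within a constant times the \<open>H1\<close> distance of the boundary values of any \<open>w\<close> in \<open>C1\<close>,
whichever trace operator is used. Density makes this distance arbitrarily small.\<close>

lemma is_trace_operator_unique:
  assumes "a < b" and S: "is_trace_operator a b S" and T: "is_trace_operator a b T"
  shows "S = T"
proof -
  have close: "\<exists>B. \<forall>u\<in>H1 a b. \<forall>w\<in>C1 a b. \<forall>x\<in>{a, b}. norm (T u x - w x) \<le> B * H1_norm a b (\<lambda>y. u y - w y)"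
    if T: "is_trace_operator a b T" for T
  proof -
    have lin: "T (\<lambda>y. u y + v y) x = T u x + T v x"
      if "u \<in> H1 a b" "v \<in> H1 a b" "x \<in> {a, b}" for u v x
      using T that unfolding is_trace_operator_def by blast
    have "\<exists>B. \<forall>u\<in>H1 a b. L2_boundary_norm a b (T u) \<le> B * H1_norm a b u"
      using T by (simp add: is_trace_operator_def)
    then obtain B where B: "\<And>u. u \<in> H1 a b \<Longrightarrow> L2_boundary_norm a b (T u) \<le> B * H1_norm a b u"
      by blast
    have "norm (T u x - w x) \<le> B * H1_norm a b (\<lambda>y. u y - w y)"
      if u: "u \<in> H1 a b" and w: "w \<in> C1 a b" and x: "x \<in> {a, b}" for u w x
    proof -
      have w_H1: "w \<in> H1 a b" using C1_subset_H1[OF \<open>a < b\<close>] w by blast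
      have d: "(\<lambda>y. u y - w y) \<in> H1 a b" by (rule H1_diff[OF \<open>a < b\<close> u w_H1])
      have "T (\<lambda>y. (u y - w y) + w y) x = T (\<lambda>y. u y - w y) x + T w x"
        by (rule lin[OF d w_H1 x])
      moreover have "T w x = w x"
        using T w x by (simp add: is_trace_operator_def)
      ultimately have "T u x - w x = T (\<lambda>y. u y - w y) x" by simp
      then show ?thesis
        using norm_le_L2_boundary_norm[OF x, of "T (\<lambda>y. u y - w y)"] B[OF d] by simp
    qed
    then show ?thesis by blast
  qed
  obtain B C where B: "\<forall>u\<in>H1 a b. \<forall>w\<in>C1 a b. \<forall>x\<in>{a, b}. norm (S u x - w x) \<le> B * H1_norm a b (\<lambda>y. u y - w y)"
    and C: "\<forall>u\<in>H1 a b. \<forall>w\<in>C1 a b. \<forall>x\<in>{a, b}. norm (T u x - w x) \<le> C * H1_norm a b (\<lambda>y. u y - w y)"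
    using close[OF S] close[OF T] by blast
  have eq: "S u x = T u x" if u: "u \<in> H1 a b" and x: "x \<in> {a, b}" for u x
  proof (rule ccontr)
    assume "S u x \<noteq> T u x"
    define d where "d = norm (S u x - T u x)"
    have d: "d > 0" using \<open>S u x \<noteq> T u x\<close> by (simp add: d_def)
    \<comment> \<open>The constants of the two operators are not known to be nonnegative; the summand 1 makes the divisor
      positive.\<close>
    define K where "K = \<bar>B\<bar> + \<bar>C\<bar> + 1"
    have K: "K > 0" by (simp add: K_def)
    obtain w where w: "w \<in> C1 a b" "H1_norm a b (\<lambda>y. u y - w y) < d / K"
      using C1_dense_in_H1[OF \<open>a < b\<close> u, of "d / K"] d K by auto
    let ?h = "H1_norm a b (\<lambda>y. u y - w y)"
    have h: "?h \<ge> 0" using order_trans[OF L2_norm_nonneg L2_norm_le_H1_norm(1)] .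
    have "d = norm ((S u x - w x) - (T u x - w x))" by (simp add: d_def)
    also have "\<dots> \<le> norm (S u x - w x) + norm (T u x - w x)" by (rule norm_triangle_ineq4)
    also have "\<dots> \<le> B * ?h + C * ?h" using B C u w(1) x by (intro add_mono) blast+
    also have "\<dots> = (B + C) * ?h" by (simp add: ring_distribs)
    also have "\<dots> \<le> K * ?h" using h by (intro mult_right_mono) (auto simp: K_def)
    also have "\<dots> < d" using w(2) K by (simp add: field_simps)
    finally show False by simp
  qed
  have ST: "S \<in> H1 a b \<rightarrow>\<^sub>E L2_boundary a b" "T \<in> H1 a b \<rightarrow>\<^sub>E L2_boundary a b"
    using S T by (auto simp: is_trace_operator_def)
  show ?thesis
  proof (rule PiE_ext[OF ST])
    fix u assume u: "u \<in> H1 a b"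
    show "S u = T u"
      by (rule PiE_ext[where k="{a, b}" and s="\<lambda>_. UNIV"])
        (use ST[THEN PiE_mem[OF _ u]] eq[OF u] in \<open>auto simp: L2_boundary_def\<close>)
  qed
qed

lemma trace_operator_eq:
  assumes "a < b"
  shows "trace_operator a b = boundary_values a b"
  unfolding trace_operator_def
proof (rule the_equality)
  show "is_trace_operator a b (boundary_values a b)"
    by (rule is_trace_operator_boundary_values[OF assms])
  show "T = boundary_values a b" if "is_trace_operator a b T" for T
    by (rule is_trace_operator_unique[OF assms that is_trace_operator_boundary_values[OF assms]])
qed

section \<open>The Poincare inequality\<close>

theorem theorem3p1:
  fixes a b :: real
  assumes "a < b"
  shows "\<exists>C_P>0. \<forall>x0\<in>{a, b}. \<forall>u\<in>H1 a b.
           L2_norm a b u \<le> C_P * (L2_norm a b (weak_deriv a b u) + norm (trace_operator a b u x0))"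
proof -
  define r where "r = sqrt (b - a)"
  have r: "r > 0" "r * r = b - a" using assms by (auto simp: r_def)
  have "L2_norm a b u \<le> (r * (1 + r)) * (L2_norm a b (weak_deriv a b u) + norm (trace_operator a b u x0))"
    if x0: "x0 \<in> {a, b}" and u: "u \<in> H1 a b" for x0 u
  proof -
    let ?D = "L2_norm a b (weak_deriv a b u)" and ?t = "norm (trace_operator a b u x0)"
    obtain g where g: "continuous_rep a b u g"
      using H1_continuous_rep[OF assms u] by metis
    have "g x0 = trace_operator a b u x0"
      using boundary_values_eq[OF assms u g x0] trace_operator_eq[OF assms] by simp
    moreover have "x0 \<in> {a..b}" using x0 assms by auto
    ultimately have "L2_norm a b u \<le> r * (?t + r * ?D)"
      using Poincare_continuous_rep[OF assms u g, of x0] by (simp add: r_def)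
    also have "\<dots> \<le> r * ((1 + r) * (?D + ?t))"
      using r(1) by (intro mult_left_mono) (auto simp: algebra_simps)
    finally show ?thesis by (simp add: mult.assoc)
  qed
  moreover have "r * (1 + r) > 0" using r(1) by simp
  ultimately show ?thesis by blast
qed

end
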